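(* Let $p\in(1,\infty)$ and let $W_p=\bigl(\bigoplus_{n\in\mathbb{N}}\ell_\infty^n\bigr)_{\ell_p}$. An operator $T\in\mathscr{B}(W_p)$ fixes the family $\{\ell_\infty^n:n\in\mathbb{N}\}$ uniformly if and only if the identity operator on $W_p$ factors through $T$.
   Context: All Banach spaces are over the same scalar field $\mathbb{K}$, either $\mathbb{R}$ or $\mathbb{C}$. An operator is a bounded, linear mapping between Banach spaces; $\mathscr{B}(X)$ is the Banach algebra of all operators on $X$. Here $\ell_\infty^n$ is $\mathbb{K}^n$ with the maximum norm, and $\bigl(\bigoplus_{n\in\mathbb{N}}X_n\bigr)_{\ell_p}$ is the Banach space of sequences $(x_n)_{n\in\mathbb{N}}$ with $x_n\in X_n$ and $\sum_{n=1}^\infty\|x_n\|^p<\infty$, with norm $\bigl(\sum_{n=1}^\infty\|x_n\|^p\bigr)^{1/p}$. The identity operator $I_X$ on $X$ factors through $T\in\mathscr{B}(X)$ if $I_X=STR$ for some $R,S\in\mathscr{B}(X)$. An operator $T\colon X\to Y$ is bounded below by $c>0$ if $\|Tx\|\geqslant c\|x\|$ for each $x\in X$. For $C\geqslant 1$ and a Banach space $E$, an operator $T\colon X\to Y$ $C$-fixes a copy of $E$ if there is an operator $S\colon E\to X$ of norm at most $C$ such that $TS$ is bounded below by $1/C$. For a non-empty family $\mathfrak{F}$ of Banach spaces, $T$ fixes the family $\mathfrak{F}$ uniformly if there is a constant $C\geqslant 1$ such that $T$ $C$-fixes a copy of each Banach space in $\mathfrak{F}$. *)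

theory Defs
  imports "HOL-Analysis.Analysis" "HOL-Library.Function_Algebras"
begin

section \<open>Banach spaces with explicit carriers\<close>

text \<open>
  The spaces below depend on a natural number or on an exponent, so a space is given by a carrier,
  a scalar multiplication and a norm on an ambient abelian group; addition is that of the ambient
  type (pointwise, for function types). Scalar multiplication and norm matter on the carrier only.
\<close>

record ('k, 'v) nspace =
  vcarrier :: "'v set"
  vscale :: "'k \<Rightarrow> 'v \<Rightarrow> 'v"
  vnorm :: "'v \<Rightarrow> real"

locale banach_space = vector_space "vscale X"
  for X :: "('k :: real_normed_field, 'v :: ab_group_add) nspace" +
  assumes subspace_carrier: "subspace (vcarrier X)"
    and vnorm_eq_0_iff: "x \<in> vcarrier X \<Longrightarrow> vnorm X x = 0 \<longleftrightarrow> x = 0"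
    and vnorm_scale: "x \<in> vcarrier X \<Longrightarrow> vnorm X (vscale X c x) = norm c * vnorm X x"
    and vnorm_triangle:
      "\<lbrakk>x \<in> vcarrier X; y \<in> vcarrier X\<rbrakk> \<Longrightarrow> vnorm X (x + y) \<le> vnorm X x + vnorm X y"
    and complete_carrier:
      "\<lbrakk>range \<sigma> \<subseteq> vcarrier X;
        \<forall>e>0. \<exists>N. \<forall>m\<ge>N. \<forall>n\<ge>N. vnorm X (\<sigma> m - \<sigma> n) < e\<rbrakk>
       \<Longrightarrow> \<exists>x\<in>vcarrier X. (\<lambda>n. vnorm X (\<sigma> n - x)) \<longlonglongrightarrow> 0"


section \<open>Operators\<close>

text \<open>Operators are constrained on the carrier only; their values elsewhere are irrelevant.\<close>

definition bounded_operator ::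
    "('k, 'v :: ab_group_add) nspace \<Rightarrow> ('k, 'w :: ab_group_add) nspace \<Rightarrow> ('v \<Rightarrow> 'w) \<Rightarrow> bool" where
  "bounded_operator X Y T \<longleftrightarrow>
     (\<forall>x\<in>vcarrier X. T x \<in> vcarrier Y) \<and>
     (\<forall>x\<in>vcarrier X. \<forall>y\<in>vcarrier X. T (x + y) = T x + T y) \<and>
     (\<forall>c. \<forall>x\<in>vcarrier X. T (vscale X c x) = vscale Y c (T x)) \<and>
     (\<exists>M. \<forall>x\<in>vcarrier X. vnorm Y (T x) \<le> M * vnorm X x)"

text \<open>The carrier version of \<^const>\<open>onorm\<close>.\<close>

definition operator_norm :: "('k, 'v) nspace \<Rightarrow> ('k, 'w) nspace \<Rightarrow> ('v \<Rightarrow> 'w) \<Rightarrow> real" where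
  "operator_norm X Y T = (SUP x\<in>vcarrier X. vnorm Y (T x) / vnorm X x)"

definition bounded_below_by ::
    "('k, 'v) nspace \<Rightarrow> ('k, 'w) nspace \<Rightarrow> ('v \<Rightarrow> 'w) \<Rightarrow> real \<Rightarrow> bool" where
  "bounded_below_by X Y T c \<longleftrightarrow> c > 0 \<and> (\<forall>x\<in>vcarrier X. vnorm Y (T x) \<ge> c * vnorm X x)"

definition fixes_copy ::
    "real \<Rightarrow> ('k, 'v :: ab_group_add) nspace \<Rightarrow> ('k, 'w) nspace \<Rightarrow> ('v \<Rightarrow> 'w) \<Rightarrow>
     ('k, 'e :: ab_group_add) nspace \<Rightarrow> bool" where
  "fixes_copy C X Y T E \<longleftrightarrow>
     (\<exists>S. bounded_operator E X S \<and> operator_norm E X S \<le> C \<and> bounded_below_by E Y (T \<circ> S) (1 / C))"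

definition fixes_uniformly ::
    "('k, 'v :: ab_group_add) nspace \<Rightarrow> ('k, 'w) nspace \<Rightarrow> ('v \<Rightarrow> 'w) \<Rightarrow>
     ('k, 'e :: ab_group_add) nspace set \<Rightarrow> bool" where
  "fixes_uniformly X Y T F \<longleftrightarrow> (\<exists>C\<ge>1. \<forall>E\<in>F. fixes_copy C X Y T E)"

definition identity_factors_through ::
    "('k, 'v :: ab_group_add) nspace \<Rightarrow> ('v \<Rightarrow> 'v) \<Rightarrow> bool" where
  "identity_factors_through X T \<longleftrightarrow>
     (\<exists>R S. bounded_operator X X R \<and> bounded_operator X X S \<and> (\<forall>x\<in>vcarrier X. S (T (R x)) = x))"


section \<open>The spaces\<close>

text \<open>Vectors of length \<open>n\<close> are sequences vanishing from \<open>n\<close> on. The norm is meaningful for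
  \<open>n \<ge> 1\<close> only.\<close>

definition linf :: "nat \<Rightarrow> ('k :: real_normed_field, nat \<Rightarrow> 'k) nspace" where
  "linf n =
     \<lparr>vcarrier = {x. \<forall>i\<ge>n. x i = 0},
      vscale = (\<lambda>c x i. c * x i),
      vnorm = (\<lambda>x. MAX i\<in>{..<n}. norm (x i))\<rparr>"

definition lp_sum :: "real \<Rightarrow> (nat \<Rightarrow> ('k, 'v) nspace) \<Rightarrow> ('k, nat \<Rightarrow> 'v) nspace" where
  "lp_sum p X =
     \<lparr>vcarrier = {x. (\<forall>n. x n \<in> vcarrier (X n)) \<and> summable (\<lambda>n. vnorm (X n) (x n) powr p)},
      vscale = (\<lambda>c x n. vscale (X n) c (x n)),
      vnorm = (\<lambda>x. (\<Sum>n. vnorm (X n) (x n) powr p) powr (1 / p))\<rparr>"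

text \<open>The summands are the \<open>linf n\<close> with \<open>n \<ge> 1\<close>; the shift is due to sequences being
  indexed from 0.\<close>

definition W :: "real \<Rightarrow> ('k :: real_normed_field, nat \<Rightarrow> nat \<Rightarrow> 'k) nspace" where
  "W p = lp_sum p (\<lambda>n. linf (Suc n))"


section \<open>The spaces are Banach spaces\<close>

context banach_space
begin

lemma carrier_diff: "x \<in> vcarrier X \<Longrightarrow> y \<in> vcarrier X \<Longrightarrow> x - y \<in> vcarrier X"
  using subspace_carrier by (rule subspace_diff)

lemma vnorm_minus: "x \<in> vcarrier X \<Longrightarrow> vnorm X (- x) = vnorm X x"
  using vnorm_scale[of x "-1"] by simp

lemma vnorm_nonneg: "x \<in> vcarrier X \<Longrightarrow> vnorm X x \<ge> 0"
  using vnorm_triangle[of x "- x"] vnorm_minus[of x] subspace_neg[OF subspace_carrier]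
    vnorm_eq_0_iff[of 0] subspace_0[OF subspace_carrier]
  by simp

lemma vnorm_diff_commute:
  assumes "x \<in> vcarrier X" "y \<in> vcarrier X"
  shows "vnorm X (x - y) = vnorm X (y - x)"
  using vnorm_minus[OF carrier_diff[OF assms]] by simp

lemma vnorm_zero: "vnorm X 0 = 0"
  using vnorm_eq_0_iff[of 0] subspace_0[OF subspace_carrier] by simp

end

lemma banach_space_linf:
  assumes n: "n \<ge> 1"
  shows "banach_space (linf n :: ('k :: {real_normed_field, banach}, nat \<Rightarrow> 'k) nspace)"
proof -
  let ?X = "linf n :: ('k, nat \<Rightarrow> 'k) nspace"
  have fin: "finite {..<n}" and ne: "{..<n} \<noteq> {}"
    using n by (auto simp: lessThan_empty_iff)
  have le_iff: "vnorm ?X x \<le> a \<longleftrightarrow> (\<forall>i<n. norm (x i) \<le> a)" for x a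
    using fin ne by (auto simp: linf_def)
  have less_iff: "vnorm ?X x < a \<longleftrightarrow> (\<forall>i<n. norm (x i) < a)" for x a
    using fin ne by (auto simp: linf_def)
  have comp: "norm (x i) \<le> vnorm ?X x" if "i < n" for x i
    using le_iff that by blast
  have nonneg: "0 \<le> vnorm ?X x" for x
    using comp[of 0 x] n by (meson norm_ge_zero order_trans less_le_trans zero_less_one)
  have vs: "vector_space (vscale ?X)"
    by unfold_locales (auto simp: linf_def fun_eq_iff algebra_simps)
  interpret vector_space "vscale ?X" by (rule vs)
  show ?thesis
  proof unfold_locales
    show "subspace (vcarrier ?X)"
      unfolding subspace_def by (auto simp: linf_def)
  next
    fix x assume x: "x \<in> vcarrier ?X"
    have "x i = 0" if "vnorm ?X x = 0" for i
    proof (cases "i < n")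
      case True
      then show ?thesis using comp[of i x] that by simp
    qed (use x in \<open>simp add: linf_def\<close>)
    moreover have "vnorm ?X 0 = 0"
      using nonneg[of 0] le_iff[of 0 0] by simp
    ultimately show "vnorm ?X x = 0 \<longleftrightarrow> x = 0"
      by (metis ext zero_fun_apply)
  next
    fix c :: 'k and x :: "nat \<Rightarrow> 'k"
    have "(MAX i\<in>{..<n}. norm c * norm (x i)) = norm c * (MAX i\<in>{..<n}. norm (x i))"
      using fin ne mono_Max_commute[of "(*) (norm c)" "(\<lambda>i. norm (x i)) ` {..<n}"]
      by (simp add: mono_def mult_left_mono image_image)
    then show "vnorm ?X (vscale ?X c x) = norm c * vnorm ?X x"
      by (simp add: linf_def norm_mult)
  next
    fix x y :: "nat \<Rightarrow> 'k"
    show "vnorm ?X (x + y) \<le> vnorm ?X x + vnorm ?X y"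
      unfolding le_iff
      by (auto intro!: order_trans[OF norm_triangle_ineq] add_mono comp)
  next
    fix \<sigma> :: "nat \<Rightarrow> nat \<Rightarrow> 'k"
    assume sub: "range \<sigma> \<subseteq> vcarrier ?X"
      and cau: "\<forall>e>0. \<exists>N. \<forall>m\<ge>N. \<forall>k\<ge>N. vnorm ?X (\<sigma> m - \<sigma> k) < e"
    define x where "x i = lim (\<lambda>m. \<sigma> m i)" for i
    have z: "\<sigma> m i = 0" if "\<not> i < n" for m i
      using subsetD[OF sub rangeI[of \<sigma> m]] that by (simp add: linf_def)
    have "Cauchy (\<lambda>m. \<sigma> m i)" for i
    proof (cases "i < n")
      case True
      show ?thesis
        using cau less_iff True by (fastforce simp: Cauchy_iff)
    qed (simp add: z Cauchy_def)
    then have lim: "(\<lambda>m. \<sigma> m i) \<longlonglongrightarrow> x i" for i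
      unfolding x_def using Cauchy_convergent convergent_LIMSEQ_iff by blast
    have "x i = 0" if "i \<ge> n" for i
      using lim[of i] z[of i] that by (simp add: LIMSEQ_const_iff)
    then have "x \<in> vcarrier ?X" by (simp add: linf_def)
    moreover have "(\<lambda>m. vnorm ?X (\<sigma> m - x)) \<longlonglongrightarrow> 0"
    proof (rule tendstoI)
      fix e :: real assume "e > 0"
      have "\<forall>\<^sub>F m in sequentially. \<forall>i\<in>{..<n}. norm (\<sigma> m i - x i) < e"
        using fin lim \<open>e > 0\<close>
        by (intro eventually_ball_finite) (auto simp: tendsto_iff dist_norm)
      then show "\<forall>\<^sub>F m in sequentially. dist (vnorm ?X (\<sigma> m - x)) 0 < e"
        by eventually_elim (use nonneg in \<open>auto simp: less_iff\<close>)
    qed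
    ultimately show "\<exists>x\<in>vcarrier ?X. (\<lambda>m. vnorm ?X (\<sigma> m - x)) \<longlonglongrightarrow> 0" by blast
  qed
qed

lemma powr_convex_nonneg:
  fixes u v s t p :: real
  assumes p: "p \<ge> 1" and "u \<ge> 0" "v \<ge> 0" and st: "s \<ge> 0" "t \<ge> 0" "s + t = 1"
  shows "(s * u + t * v) powr p \<le> s * u powr p + t * v powr p"
proof -
  have small: "r powr p \<le> r" if "0 \<le> r" "r \<le> 1" for r :: real
    using powr_mono'[of 1 p r] that p by simp
  have scaled: "(r * w) powr p \<le> r * w powr p" if "0 \<le> r" "r \<le> 1" "0 \<le> w" for r w :: real
    using that small[of r] by (simp add: powr_mult mult_right_mono)
  consider "u = 0" | "v = 0" | "u > 0" "v > 0" using assms by linarith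
  then show ?thesis
  proof cases
    case 1
    then show ?thesis using scaled[of t v] assms by simp
  next
    case 2
    then show ?thesis using scaled[of s u] assms by simp
  next
    case 3
    then show ?thesis
      using convex_onD[OF powr_convex[OF p], of t u v] st by (simp add: eq_diff_eq[symmetric])
  qed
qed

lemma Minkowski_seq:
  fixes a b :: "nat \<Rightarrow> real"
  assumes p: "p \<ge> 1" and a: "\<And>n. a n \<ge> 0" and b: "\<And>n. b n \<ge> 0"
    and sa: "summable (\<lambda>n. a n powr p)" and sb: "summable (\<lambda>n. b n powr p)"
  shows "summable (\<lambda>n. (a n + b n) powr p)"
    and "(\<Sum>n. (a n + b n) powr p) powr (1 / p)
           \<le> (\<Sum>n. a n powr p) powr (1 / p) + (\<Sum>n. b n powr p) powr (1 / p)"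
proof -
  define A where "A = (\<Sum>n. a n powr p) powr (1 / p)"
  define B where "B = (\<Sum>n. b n powr p) powr (1 / p)"
  have pow: "(\<Sum>n. a n powr p) = A powr p" "(\<Sum>n. b n powr p) = B powr p"
    using p by (auto simp: A_def B_def powr_powr suminf_nonneg sa sb)
  have A: "A \<ge> 0" and B: "B \<ge> 0" by (auto simp: A_def B_def)
  have zero: "f = (\<lambda>_. 0)" if "(\<Sum>n. f n powr p) = 0" "summable (\<lambda>n. f n powr p)" for f :: "nat \<Rightarrow> real"
    using suminf_eq_zero_iff[OF that(2)] that(1) by (auto simp: fun_eq_iff)
  have "summable (\<lambda>n. (a n + b n) powr p) \<and> (\<Sum>n. (a n + b n) powr p) powr (1 / p) \<le> A + B"
  proof (cases "A = 0 \<or> B = 0")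
    case True
    then show ?thesis
    proof
      assume "A = 0"
      then have "a = (\<lambda>_. 0)" using zero[OF _ sa] pow p by simp
      then show ?thesis using sb A by (simp add: B_def)
    next
      assume "B = 0"
      then have "b = (\<lambda>_. 0)" using zero[OF _ sb] pow p by simp
      then show ?thesis using sa B by (simp add: A_def)
    qed
  next
    case False
    with A B have pos: "A > 0" "B > 0" by auto
    define C where "C = A + B"
    have C: "C > 0" using pos by (simp add: C_def)
    define g where "g n = C powr p * (A / C * (a n powr p / A powr p) + B / C * (b n powr p / B powr p))" for n
    have le: "(a n + b n) powr p \<le> g n" for n
    proof -
      have "(a n + b n) powr p = C powr p * (A / C * (a n / A) + B / C * (b n / B)) powr p"
      proof -
        have "A / C * (a n / A) + B / C * (b n / B) = (a n + b n) / C"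
          using pos C by (simp add: field_simps)
        then show ?thesis
          using C a[of n] b[of n] by (simp add: powr_divide)
      qed
      also have "\<dots> \<le> C powr p * (A / C * (a n / A) powr p + B / C * (b n / B) powr p)"
        using pos C a[of n] b[of n] p
        by (intro mult_left_mono powr_convex_nonneg)
           (auto simp: C_def add_divide_distrib[symmetric])
      also have "\<dots> = g n"
        using pos a[of n] b[of n] by (simp add: g_def powr_divide)
      finally show ?thesis .
    qed
    have "g sums (C powr p * (A / C * (A powr p / A powr p) + B / C * (B powr p / B powr p)))"
      unfolding g_def
      using sa sb pow by (intro sums_mult sums_add sums_divide) (metis summable_sums)+
    also have "C powr p * (A / C * (A powr p / A powr p) + B / C * (B powr p / B powr p)) = C powr p"
      using pos C by (simp add: C_def add_divide_distrib[symmetric])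
    finally have g: "g sums (C powr p)" .
    have s: "summable (\<lambda>n. (a n + b n) powr p)"
      by (rule summable_comparison_test'[OF sums_summable[OF g]]) (use le in simp)
    have "(\<Sum>n. (a n + b n) powr p) \<le> C powr p"
      using suminf_le[OF le s sums_summable[OF g]] sums_unique[OF g] by simp
    then have "(\<Sum>n. (a n + b n) powr p) powr (1 / p) \<le> (C powr p) powr (1 / p)"
      using p s by (intro powr_mono2) (auto intro: suminf_nonneg)
    then show ?thesis using s p C by (simp add: powr_powr C_def)
  qed
  then show "summable (\<lambda>n. (a n + b n) powr p)"
    and "(\<Sum>n. (a n + b n) powr p) powr (1 / p)
           \<le> (\<Sum>n. a n powr p) powr (1 / p) + (\<Sum>n. b n powr p) powr (1 / p)"
    by (auto simp: A_def B_def)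
qed

lemma banach_space_lp_sum:
  fixes X :: "nat \<Rightarrow> ('k :: real_normed_field, 'v :: ab_group_add) nspace"
  assumes p: "p \<ge> 1" and X: "\<And>n. banach_space (X n)"
  shows "banach_space (lp_sum p X)"
proof -
  interpret X: banach_space "X n" for n by (rule X)
  let ?S = "lp_sum p X"
  let ?P = "\<lambda>x n. vnorm (X n) (x n) powr p"
  have mem: "x \<in> vcarrier ?S \<longleftrightarrow> (\<forall>n. x n \<in> vcarrier (X n)) \<and> summable (?P x)" for x
    by (simp add: lp_sum_def)
  have nrm: "vnorm ?S x = (\<Sum>n. ?P x n) powr (1 / p)" for x
    by (simp add: lp_sum_def)
  have scl: "vscale ?S c x n = vscale (X n) c (x n)" for c x n
    by (simp add: lp_sum_def)
  have pow: "(\<Sum>n. ?P x n) = vnorm ?S x powr p" if "x \<in> vcarrier ?S" for x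
    using p that by (simp add: nrm powr_powr suminf_nonneg mem)
  have add_mem: "x + y \<in> vcarrier ?S"
    and add_le: "vnorm ?S (x + y) \<le> vnorm ?S x + vnorm ?S y"
    if x: "x \<in> vcarrier ?S" and y: "y \<in> vcarrier ?S" for x y
  proof -
    let ?a = "\<lambda>n. vnorm (X n) (x n)" and ?b = "\<lambda>n. vnorm (X n) (y n)"
    have c: "x n \<in> vcarrier (X n)" "y n \<in> vcarrier (X n)" "x n + y n \<in> vcarrier (X n)" for n
      using x y X.subspace_add[OF X.subspace_carrier] by (auto simp: mem)
    have nn: "?a n \<ge> 0" "?b n \<ge> 0" for n using c X.vnorm_nonneg by auto
    have s: "summable (?P x)" "summable (?P y)" using x y by (auto simp: mem)
    note M = Minkowski_seq[OF p nn s]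
    have le: "?P (x + y) n \<le> (?a n + ?b n) powr p" for n
      using c[of n] p by (auto intro!: powr_mono2 X.vnorm_nonneg X.vnorm_triangle)
    have s': "summable (?P (x + y))"
      by (rule summable_comparison_test'[OF M(1)]) (use le in simp)
    then show "x + y \<in> vcarrier ?S" using c by (simp add: mem)
    have "(\<Sum>n. ?P (x + y) n) powr (1 / p) \<le> (\<Sum>n. (?a n + ?b n) powr p) powr (1 / p)"
      using p suminf_le[OF le s' M(1)] suminf_nonneg[OF s'] by (intro powr_mono2) auto
    with M(2) show "vnorm ?S (x + y) \<le> vnorm ?S x + vnorm ?S y"
      by (simp add: nrm)
  qed
  have P_scale: "?P (vscale ?S c x) n = norm c powr p * ?P x n" if "x \<in> vcarrier ?S" for c x n
    using that X.vnorm_nonneg[of "x n" n] by (simp add: scl mem X.vnorm_scale powr_mult)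
  have scale_mem: "vscale ?S c x \<in> vcarrier ?S" if x: "x \<in> vcarrier ?S" for c x
    using x X.subspace_scale[OF X.subspace_carrier] summable_mult[of "?P x" "norm c powr p"]
      P_scale[OF x]
    by (auto simp: mem scl)
  have zero_mem: "0 \<in> vcarrier ?S"
    using X.subspace_0[OF X.subspace_carrier] by (simp add: mem X.vnorm_zero)
  have vs: "vector_space (vscale ?S)"
    by unfold_locales (auto simp: scl fun_eq_iff X.scale_right_distrib X.scale_left_distrib)
  interpret vector_space "vscale ?S" by (rule vs)
  have sub: "subspace (vcarrier ?S)"
    using add_mem scale_mem zero_mem by (simp add: subspace_def)
  have diff_mem: "x - y \<in> vcarrier ?S" if "x \<in> vcarrier ?S" "y \<in> vcarrier ?S" for x y
    using subspace_diff[OF sub that] .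
  show ?thesis
  proof unfold_locales
    show "subspace (vcarrier ?S)" by (rule sub)
  next
    fix x assume x: "x \<in> vcarrier ?S"
    have "vnorm ?S x = 0 \<longleftrightarrow> (\<forall>n. ?P x n = 0)"
      using x suminf_eq_zero_iff[of "?P x"] by (simp add: nrm mem)
    also have "\<dots> \<longleftrightarrow> x = 0"
      using x X.vnorm_eq_0_iff by (auto simp: mem fun_eq_iff)
    finally show "vnorm ?S x = 0 \<longleftrightarrow> x = 0" .
  next
    fix c :: 'k and x assume x: "x \<in> vcarrier ?S"
    have "summable (?P x)" using x by (simp add: mem)
    then have "(\<Sum>n. norm c powr p * ?P x n) = norm c powr p * (\<Sum>n. ?P x n)"
      by (rule suminf_mult)
    then show "vnorm ?S (vscale ?S c x) = norm c * vnorm ?S x"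
      using p x by (simp add: nrm P_scale powr_mult powr_powr suminf_nonneg mem)
  next
    fix x y assume "x \<in> vcarrier ?S" "y \<in> vcarrier ?S"
    then show "vnorm ?S (x + y) \<le> vnorm ?S x + vnorm ?S y" by (rule add_le)
  next
    fix \<sigma> :: "nat \<Rightarrow> nat \<Rightarrow> 'v"
    assume ran: "range \<sigma> \<subseteq> vcarrier ?S"
      and cau: "\<forall>e>0. \<exists>N. \<forall>m\<ge>N. \<forall>k\<ge>N. vnorm ?S (\<sigma> m - \<sigma> k) < e"
    have \<sigma>: "\<sigma> m \<in> vcarrier ?S" for m using ran by auto
    have \<sigma>n: "\<sigma> m n \<in> vcarrier (X n)" for m n using \<sigma>[of m] by (simp add: mem)
    have comp: "vnorm (X n) (x n) \<le> vnorm ?S x" if "x \<in> vcarrier ?S" for x n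
    proof -
      have "?P x n \<le> (\<Sum>n. ?P x n)"
        using that sum_le_suminf[of "?P x" "{n}"] by (simp add: mem)
      then have "?P x n powr (1 / p) \<le> vnorm ?S x"
        unfolding nrm using p by (intro powr_mono2) auto
      then show ?thesis using p that X.vnorm_nonneg[of "x n" n] by (simp add: powr_powr mem)
    qed
    have "\<exists>x\<in>vcarrier (X n). (\<lambda>m. vnorm (X n) (\<sigma> m n - x)) \<longlonglongrightarrow> 0" for n
    proof (rule X.complete_carrier)
      show "range (\<lambda>m. \<sigma> m n) \<subseteq> vcarrier (X n)" using \<sigma>n by auto
      have "vnorm (X n) (\<sigma> m n - \<sigma> k n) \<le> vnorm ?S (\<sigma> m - \<sigma> k)" for m k
        using comp[OF diff_mem[OF \<sigma> \<sigma>]] by simp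
      then show "\<forall>e>0. \<exists>N. \<forall>m\<ge>N. \<forall>k\<ge>N. vnorm (X n) (\<sigma> m n - \<sigma> k n) < e"
        using cau by (meson le_less_trans)
    qed
    then obtain x where xn: "x n \<in> vcarrier (X n)"
      and lim: "(\<lambda>m. vnorm (X n) (\<sigma> m n - x n)) \<longlonglongrightarrow> 0" for n by metis
    have key: "\<exists>N. \<forall>m\<ge>N. \<sigma> m - x \<in> vcarrier ?S \<and> vnorm ?S (\<sigma> m - x) \<le> e" if e: "e > 0" for e
    proof -
      obtain N where N: "vnorm ?S (\<sigma> m - \<sigma> k) < e" if "m \<ge> N" "k \<ge> N" for m k
        using cau e by blast
      have "\<sigma> m - x \<in> vcarrier ?S \<and> vnorm ?S (\<sigma> m - x) \<le> e" if m: "m \<ge> N" for m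
      proof -
        have bound: "(\<Sum>n<L. ?P (\<sigma> m - x) n) \<le> e powr p" for L
        proof (rule tendsto_upperbound)
          have "(\<lambda>k. vnorm (X n) (\<sigma> m n - \<sigma> k n)) \<longlonglongrightarrow> vnorm (X n) (\<sigma> m n - x n)" for n
          proof (rule LIM_zero_cancel, rule Lim_null_comparison[OF always_eventually lim[of n]], rule allI)
            fix k
            have mem1: "\<sigma> m n - \<sigma> k n \<in> vcarrier (X n)" "\<sigma> m n - x n \<in> vcarrier (X n)"
                "\<sigma> k n - x n \<in> vcarrier (X n)" "x n - \<sigma> k n \<in> vcarrier (X n)"
              using \<sigma>n xn X.carrier_diff by auto
            show "norm (vnorm (X n) (\<sigma> m n - \<sigma> k n) - vnorm (X n) (\<sigma> m n - x n))
                    \<le> vnorm (X n) (\<sigma> k n - x n)"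
              using X.vnorm_triangle[OF mem1(1,3)] X.vnorm_triangle[OF mem1(2,4)]
                X.vnorm_diff_commute[OF xn \<sigma>n, of n k]
              by simp
          qed
          then show "(\<lambda>k. \<Sum>n<L. ?P (\<sigma> m - \<sigma> k) n) \<longlonglongrightarrow> (\<Sum>n<L. ?P (\<sigma> m - x) n)"
            using p by (intro tendsto_sum tendsto_powr')
              (auto intro!: always_eventually X.vnorm_nonneg X.carrier_diff \<sigma>n)
          have "(\<Sum>n<L. ?P (\<sigma> m - \<sigma> k) n) \<le> e powr p" if "k \<ge> N" for k
          proof -
            have d: "\<sigma> m - \<sigma> k \<in> vcarrier ?S" using \<sigma> diff_mem by blast
            have "(\<Sum>n<L. ?P (\<sigma> m - \<sigma> k) n) \<le> (\<Sum>n. ?P (\<sigma> m - \<sigma> k) n)"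
              using d unfolding mem by (intro sum_le_suminf) auto
            also have "\<dots> \<le> e powr p"
              unfolding pow[OF d] using p N[OF m that] by (intro powr_mono2) (auto simp: nrm)
            finally show ?thesis .
          qed
          then show "\<forall>\<^sub>F k in sequentially. (\<Sum>n<L. ?P (\<sigma> m - \<sigma> k) n) \<le> e powr p"
            by (auto simp: eventually_sequentially)
        qed simp
        have s: "summable (?P (\<sigma> m - x))"
          by (rule bounded_imp_summable[where B = "e powr p"])
             (use bound[of "Suc _"] in \<open>auto simp: lessThan_Suc_atMost\<close>)
        then have "\<sigma> m - x \<in> vcarrier ?S"
          using \<sigma>n xn X.carrier_diff by (simp add: mem)
        moreover have "vnorm ?S (\<sigma> m - x) \<le> (e powr p) powr (1 / p)"
          unfolding nrm using p s bound suminf_le_const[OF s, of "e powr p"]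
          by (intro powr_mono2 suminf_nonneg) auto
        ultimately show ?thesis using p e by (simp add: powr_powr)
      qed
      then show ?thesis by blast
    qed
    obtain m where "\<sigma> m - x \<in> vcarrier ?S" using key[of 1] by auto
    then have "\<sigma> m - (\<sigma> m - x) \<in> vcarrier ?S" using \<sigma> diff_mem by blast
    then have "x \<in> vcarrier ?S" by simp
    moreover have "(\<lambda>m. vnorm ?S (\<sigma> m - x)) \<longlonglongrightarrow> 0"
    proof (rule LIMSEQ_I)
      fix r :: real assume "r > 0"
      then obtain N where "\<forall>m\<ge>N. vnorm ?S (\<sigma> m - x) \<le> r / 2" using key[of "r / 2"] by auto
      then show "\<exists>N. \<forall>m\<ge>N. norm (vnorm ?S (\<sigma> m - x) - 0) < r"
        using \<open>r > 0\<close> by (intro exI[of _ N]) (force simp: nrm)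
    qed
    ultimately show "\<exists>x\<in>vcarrier ?S. (\<lambda>m. vnorm ?S (\<sigma> m - x)) \<longlonglongrightarrow> 0" by blast
  qed
qed

lemma banach_space_W:
  "p \<ge> 1 \<Longrightarrow> banach_space (W p :: ('k :: {real_normed_field, banach}, nat \<Rightarrow> nat \<Rightarrow> 'k) nspace)"
  unfolding W_def by (intro banach_space_lp_sum banach_space_linf) auto

end

theory Submission
  imports Defs
begin

text \<open>
  If \<open>S T R = I\<close>, then each \<open>\<ell>\<^sub>\<infinity>\<^sup>n\<close> embeds isometrically into \<open>W p\<close> as a summand, and the restriction of \<open>R\<close> to
  that summand witnesses that \<open>T\<close> fixes it, with a constant depending on the norms of \<open>R\<close> and
  \<open>S\<close> alone (\<open>fixes_linf_if_identity_factors\<close>).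

  Conversely, let \<open>T\<close> fix all \<open>\<ell>\<^sub>\<infinity>\<^sup>N\<close> with the same constant \<open>C\<close>, say through embeddings \<open>U\<close>
  of norm at most \<open>C\<close>. The point is that a large \<open>N\<close> leaves room for a choice of \<open>n\<close> of the unit
  vectors \<open>e\<^sub>i\<close> for which \<open>x\<^sub>i = U e\<^sub>i\<close> and \<open>y\<^sub>i = T x\<^sub>i\<close> are in almost perfect position. The
  reason is that the dual of \<open>\<ell>\<^sub>\<infinity>\<^sup>N\<close> is \<open>\<ell>\<^sub>1\<^sup>N\<close>: a functional of norm at most \<open>c\<close> on \<open>\<ell>\<^sub>\<infinity>\<^sup>N\<close> exceeds
  \<open>\<eta>\<close> on at most \<open>c / \<eta>\<close> unit vectors, whatever \<open>N\<close> is (\<open>sum_functional_basis_le\<close>). Applied to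
  the finitely many coordinates in the first \<open>m\<close> summands of \<open>W p\<close>, this makes \<open>x\<^sub>i\<close> and
  \<open>y\<^sub>i\<close> almost vanish there for all but boundedly many \<open>i\<close>; tails are small anyway, so \<open>x\<^sub>i\<close> and
  \<open>y\<^sub>i\<close> live almost entirely on some window \<open>{m..<m'}\<close>. Applied to functionals \<open>f\<^sub>i\<close> that norm
  the \<open>y\<^sub>i\<close> on this window, it bounds, for each \<open>i\<close>, the number of \<open>k\<close> with \<open>\<bar>f\<^sub>i y\<^sub>k\<bar> > \<eta>\<close>. This
  is a digraph of bounded out-degree, which has large independent sets
  (\<open>digraph_independent_set\<close>), and on such a set the \<open>f\<^sub>i\<close> are almost biorthogonal to the \<open>y\<^sub>i\<close>.
  The outcome is \<open>almost_dual_block_exists\<close>.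

  Performing this for \<open>n = 1, 2, 3, \<dots>\<close> on successive disjoint windows, let \<open>R\<close> map the unit vectors
  of the summand of dimension \<open>n\<close> to the \<open>n\<close> selected vectors of the corresponding window, and
  let \<open>S\<close> read off the values of the \<open>n\<close> functionals. Disjointness of the windows makes \<open>R\<close> and \<open>S\<close>
  bounded for the \<open>\<ell>\<^sub>p\<close>-norm, and \<open>S T R\<close> differs from the identity on each unit vector by an amount so
  small that \<open>\<parallel>S T R - I\<parallel> \<le> 1/2\<close> (\<open>bounded_near_identity_on_basis\<close>). Then \<open>S T R\<close> has a bounded
  right inverse \<open>H\<close> by completeness (\<open>right_inverse_near_identity\<close>), and \<open>S T (R H) = I\<close>. The
  functionals behind \<open>S\<close> are given by explicit formulas, which makes the argument uniform in the
  scalar field: it treats all complete normed fields over the reals at once.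
\<close>

section \<open>Bounded operators on spaces with explicit carriers\<close>

lemma (in banach_space) vnorm_sum_le:
  assumes "\<And>i. i \<in> I \<Longrightarrow> x i \<in> vcarrier X"
  shows "(\<Sum>i\<in>I. x i) \<in> vcarrier X" "vnorm X (\<Sum>i\<in>I. x i) \<le> (\<Sum>i\<in>I. vnorm X (x i))"
proof -
  have "(\<Sum>i\<in>I. x i) \<in> vcarrier X \<and> vnorm X (\<Sum>i\<in>I. x i) \<le> (\<Sum>i\<in>I. vnorm X (x i))"
    using assms
  proof (induction I rule: infinite_finite_induct)
    case (insert i I)
    then have IH: "(\<Sum>i\<in>I. x i) \<in> vcarrier X" "vnorm X (\<Sum>i\<in>I. x i) \<le> (\<Sum>i\<in>I. vnorm X (x i))"
      and xi: "x i \<in> vcarrier X" by auto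
    have "vnorm X (x i + (\<Sum>i\<in>I. x i)) \<le> vnorm X (x i) + (\<Sum>i\<in>I. vnorm X (x i))"
      using vnorm_triangle[OF xi IH(1)] IH(2) by linarith
    then show ?case
      using subspace_add[OF subspace_carrier xi IH(1)] by (simp only: sum.insert[OF insert.hyps])
  qed (simp_all only: sum.infinite sum.empty subspace_0[OF subspace_carrier] vnorm_zero simp_thms order_refl)
  then show "(\<Sum>i\<in>I. x i) \<in> vcarrier X" "vnorm X (\<Sum>i\<in>I. x i) \<le> (\<Sum>i\<in>I. vnorm X (x i))" by auto
qed

lemma (in banach_space) vnorm_diff_le:
  assumes "x \<in> vcarrier X" "y \<in> vcarrier X"
  shows "vnorm X (x - y) \<le> vnorm X x + vnorm X y"
  using vnorm_triangle[OF assms(1) subspace_neg[OF subspace_carrier assms(2)]] vnorm_minus[OF assms(2)]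
  by simp

lemma bounded_operatorD:
  assumes "bounded_operator X Y T"
  shows "x \<in> vcarrier X \<Longrightarrow> T x \<in> vcarrier Y"
    and "x \<in> vcarrier X \<Longrightarrow> y \<in> vcarrier X \<Longrightarrow> T (x + y) = T x + T y"
    and "x \<in> vcarrier X \<Longrightarrow> T (vscale X c x) = vscale Y c (T x)"
  using assms by (auto simp: bounded_operator_def)

lemma bounded_operator_bound:
  assumes "bounded_operator X Y T" "banach_space X"
  obtains M where "M \<ge> 1" "\<And>x. x \<in> vcarrier X \<Longrightarrow> vnorm Y (T x) \<le> M * vnorm X x"
proof -
  interpret X: banach_space X by fact
  obtain M where M: "\<forall>x\<in>vcarrier X. vnorm Y (T x) \<le> M * vnorm X x"
    using assms by (auto simp: bounded_operator_def)
  have "vnorm Y (T x) \<le> max 1 M * vnorm X x" if "x \<in> vcarrier X" for x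
    using M that X.vnorm_nonneg[OF that] by (meson max.cobounded2 mult_right_mono order_trans)
  then show ?thesis using that[of "max 1 M"] by auto
qed

lemma bounded_operator_comp:
  assumes T: "bounded_operator X Y T" and S: "bounded_operator Y Z S"
    and "banach_space X" "banach_space Y"
  shows "bounded_operator X Z (S \<circ> T)"
proof -
  obtain M where M: "M \<ge> 1" "\<And>x. x \<in> vcarrier X \<Longrightarrow> vnorm Y (T x) \<le> M * vnorm X x"
    using bounded_operator_bound[OF T] assms by blast
  obtain N where N: "N \<ge> 1" "\<And>x. x \<in> vcarrier Y \<Longrightarrow> vnorm Z (S x) \<le> N * vnorm Y x"
    using bounded_operator_bound[OF S] assms by blast
  have "vnorm Z (S (T x)) \<le> N * M * vnorm X x" if "x \<in> vcarrier X" for x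
    using N(2)[OF bounded_operatorD(1)[OF T that]] mult_left_mono[OF M(2)[OF that], of N] N(1)
    by (simp only: mult.assoc) linarith
  then show ?thesis
    using bounded_operatorD[OF T] bounded_operatorD[OF S] by (auto simp: bounded_operator_def)
qed

lemma bounded_operator_diff:
  assumes T: "bounded_operator X Y T" and "banach_space X"
    and xy: "x \<in> vcarrier X" "y \<in> vcarrier X"
  shows "T (x - y) = T x - T y"
proof -
  interpret X: banach_space X by fact
  have "T (x - y + y) = T (x - y) + T y"
    using xy by (intro bounded_operatorD[OF T] X.carrier_diff)
  then show ?thesis by simp
qed

lemma bounded_operator_sum:
  assumes T: "bounded_operator X Y T" and "banach_space X" "finite I"
    and x: "\<And>i. i \<in> I \<Longrightarrow> x i \<in> vcarrier X"
  shows "(\<Sum>i\<in>I. vscale X (c i) (x i)) \<in> vcarrier X"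
    and "T (\<Sum>i\<in>I. vscale X (c i) (x i)) = (\<Sum>i\<in>I. vscale Y (c i) (T (x i)))"
proof -
  interpret X: banach_space X by fact
  have T0: "T 0 = 0"
    using bounded_operatorD(2)[OF T, of 0 0] X.subspace_0[OF X.subspace_carrier] by simp
  have "(\<Sum>i\<in>I. vscale X (c i) (x i)) \<in> vcarrier X \<and>
    T (\<Sum>i\<in>I. vscale X (c i) (x i)) = (\<Sum>i\<in>I. vscale Y (c i) (T (x i)))"
    using \<open>finite I\<close> x
  proof (induction I rule: finite_induct)
    case empty
    then show ?case using T0 X.subspace_0[OF X.subspace_carrier] by simp
  next
    case (insert i I)
    have xi: "x i \<in> vcarrier X" using insert.prems by simp
    have sx: "vscale X (c i) (x i) \<in> vcarrier X" by (rule X.subspace_scale[OF X.subspace_carrier xi])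
    have IH: "(\<Sum>i\<in>I. vscale X (c i) (x i)) \<in> vcarrier X"
      "T (\<Sum>i\<in>I. vscale X (c i) (x i)) = (\<Sum>i\<in>I. vscale Y (c i) (T (x i)))"
      using insert.IH insert.prems by auto
    show ?case
      using X.subspace_add[OF X.subspace_carrier sx IH(1)] bounded_operatorD(2)[OF T sx IH(1)]
      by (simp only: sum.insert[OF insert.hyps] bounded_operatorD(3)[OF T xi] IH(2))
  qed
  then show "(\<Sum>i\<in>I. vscale X (c i) (x i)) \<in> vcarrier X"
    and "T (\<Sum>i\<in>I. vscale X (c i) (x i)) = (\<Sum>i\<in>I. vscale Y (c i) (T (x i)))" by auto
qed

lemma operator_norm_le_imp:
  assumes S: "bounded_operator X Y S" "banach_space X" "banach_space Y" and "operator_norm X Y S \<le> C"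
    and x: "x \<in> vcarrier X"
  shows "vnorm Y (S x) \<le> C * vnorm X x"
proof -
  interpret X: banach_space X by fact
  interpret Y: banach_space Y by fact
  obtain M where M: "M \<ge> 1" "\<And>x. x \<in> vcarrier X \<Longrightarrow> vnorm Y (S x) \<le> M * vnorm X x"
    using bounded_operator_bound[OF S(1,2)] by blast
  have "vnorm Y (S z) / vnorm X z \<le> M" if "z \<in> vcarrier X" for z
  proof (cases "vnorm X z = 0")
    case False
    then show ?thesis using M(2)[OF that] X.vnorm_nonneg[OF that] by (simp add: divide_le_eq)
  qed (use M in auto)
  then have "bdd_above ((\<lambda>z. vnorm Y (S z) / vnorm X z) ` vcarrier X)" by (auto intro!: bdd_aboveI)
  then have "vnorm Y (S x) / vnorm X x \<le> operator_norm X Y S"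
    unfolding operator_norm_def using x by (intro cSUP_upper)
  with assms(4) have le: "vnorm Y (S x) / vnorm X x \<le> C" by simp
  show ?thesis
  proof (cases "vnorm X x = 0")
    case True
    then show ?thesis using M(2)[OF x] by simp
  next
    case False
    then show ?thesis using le X.vnorm_nonneg[OF x] by (simp add: divide_le_eq)
  qed
qed

lemma operator_norm_leI:
  assumes "banach_space X" "C \<ge> 0" and le: "\<And>x. x \<in> vcarrier X \<Longrightarrow> vnorm Y (S x) \<le> C * vnorm X x"
  shows "operator_norm X Y S \<le> C"
  unfolding operator_norm_def
proof (rule cSUP_least)
  interpret X: banach_space X by fact
  show "vcarrier X \<noteq> {}" using X.subspace_0[OF X.subspace_carrier] by auto
  fix x assume x: "x \<in> vcarrier X"
  show "vnorm Y (S x) / vnorm X x \<le> C"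
  proof (cases "vnorm X x = 0")
    case False
    then show ?thesis using le[OF x] X.vnorm_nonneg[OF x] by (simp add: divide_le_eq)
  qed (use assms in auto)
qed

text \<open>
  The Neumann series argument, in the form of the fixed point iteration for \<open>x = y - (A x - x)\<close>. The
  estimate \<open>(1 - q) \<parallel>x\<parallel> \<le> \<parallel>A x\<parallel>\<close> gives uniqueness of the solution, hence linearity of the
  inverse, and its bound.
\<close>

lemma right_inverse_near_identity:
  fixes X :: "('k::real_normed_field, 'v::ab_group_add) nspace"
  assumes X: "banach_space X" and A: "bounded_operator X X A" and q: "0 \<le> q" "q < 1"
    and near: "\<And>x. x \<in> vcarrier X \<Longrightarrow> vnorm X (A x - x) \<le> q * vnorm X x"
  obtains H where "bounded_operator X X H" "\<And>y. y \<in> vcarrier X \<Longrightarrow> A (H y) = y"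
proof -
  interpret X: banach_space X by fact
  note sub = X.subspace_carrier
  have zero [simp]: "0 \<in> vcarrier X" by (rule X.subspace_0[OF sub])
  have below: "(1 - q) * vnorm X x \<le> vnorm X (A x)" if x: "x \<in> vcarrier X" for x
  proof -
    have "vnorm X (A x - (A x - x)) \<le> vnorm X (A x) + vnorm X (A x - x)"
      using x bounded_operatorD[OF A] X.carrier_diff by (intro X.vnorm_diff_le) auto
    then show ?thesis using near[OF x] by (simp add: algebra_simps)
  qed
  have inj: "x = y" if "x \<in> vcarrier X" "y \<in> vcarrier X" "A x = A y" for x y
  proof -
    have d: "x - y \<in> vcarrier X" using that X.carrier_diff by simp
    have "(1 - q) * vnorm X (x - y) \<le> 0"
      using below[OF d] bounded_operator_diff[OF A X that(1,2)] that(3) X.vnorm_zero by simp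
    then have "vnorm X (x - y) = 0" using q X.vnorm_nonneg[OF d] by (simp add: mult_le_0_iff)
    then show ?thesis using X.vnorm_eq_0_iff[OF d] by simp
  qed
  have surj: "\<exists>x\<in>vcarrier X. A x = y" if y: "y \<in> vcarrier X" for y
  proof -
    define \<sigma> where "\<sigma> = rec_nat 0 (\<lambda>_ x. y - (A x - x))"
    have \<sigma>Suc: "\<sigma> (Suc n) = y - (A (\<sigma> n) - \<sigma> n)" for n by (simp add: \<sigma>_def)
    have \<sigma>: "\<sigma> n \<in> vcarrier X" for n
    proof (induction n)
      case 0
      then show ?case by (simp add: \<sigma>_def)
    next
      case (Suc n)
      then show ?case unfolding \<sigma>Suc using y bounded_operatorD[OF A] by (intro X.carrier_diff) auto
    qed
    have dm: "\<sigma> m - \<sigma> n \<in> vcarrier X" for m n using \<sigma> X.carrier_diff by simp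
    have step: "vnorm X (\<sigma> (Suc m) - \<sigma> (Suc n)) \<le> q * vnorm X (\<sigma> m - \<sigma> n)" for m n
    proof -
      have "\<sigma> (Suc m) - \<sigma> (Suc n) = - (A (\<sigma> m - \<sigma> n) - (\<sigma> m - \<sigma> n))"
        by (simp add: \<sigma>Suc bounded_operator_diff[OF A X \<sigma> \<sigma>])
      then show ?thesis
        using near[OF dm, of m n] X.vnorm_minus[OF X.carrier_diff[OF bounded_operatorD(1)[OF A dm] dm]]
        by metis
    qed
    have geo: "vnorm X (\<sigma> (n + k) - \<sigma> n) \<le> q ^ n * (vnorm X y / (1 - q))" for n k
    proof (induction n)
      case 0
      have "(1 - q) * vnorm X (\<sigma> k) \<le> vnorm X y"
      proof (induction k)
        case 0
        then show ?case using X.vnorm_nonneg[OF y] X.vnorm_zero by (simp add: \<sigma>_def)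
      next
        case (Suc k)
        have d: "A (\<sigma> k) - \<sigma> k \<in> vcarrier X"
          by (intro X.carrier_diff bounded_operatorD(1)[OF A] \<sigma>)
        have "vnorm X (\<sigma> (Suc k)) \<le> vnorm X y + vnorm X (A (\<sigma> k) - \<sigma> k)"
          unfolding \<sigma>Suc by (rule X.vnorm_diff_le[OF y d])
        also have "\<dots> \<le> vnorm X y + q * vnorm X (\<sigma> k)"
          using near[OF \<sigma>, of k] by simp
        finally have "(1 - q) * vnorm X (\<sigma> (Suc k)) \<le> (1 - q) * vnorm X y + q * ((1 - q) * vnorm X (\<sigma> k))"
          using q mult_left_mono[of "vnorm X (\<sigma> (Suc k))" "vnorm X y + q * vnorm X (\<sigma> k)" "1 - q"]
          by (simp add: algebra_simps)
        also have "\<dots> \<le> (1 - q) * vnorm X y + q * vnorm X y" using Suc q by (intro add_left_mono mult_left_mono)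
        finally show ?case by (simp add: algebra_simps)
      qed
      then have "vnorm X (\<sigma> k) \<le> vnorm X y / (1 - q)"
        using q by (intro mult_imp_le_div_pos) (simp_all only: mult.commute diff_gt_0_iff_gt)
      moreover have "\<sigma> (0 + k) - \<sigma> 0 = \<sigma> k" by (simp add: \<sigma>_def)
      ultimately show ?case by (simp only: power_0 mult_1_left)
    next
      case (Suc n)
      have "vnorm X (\<sigma> (Suc n + k) - \<sigma> (Suc n)) \<le> q * vnorm X (\<sigma> (n + k) - \<sigma> n)"
        using step[of "n + k" n] by simp
      also have "\<dots> \<le> q * (q ^ n * (vnorm X y / (1 - q)))" using Suc q by (intro mult_left_mono)
      finally show ?case by (simp add: mult.assoc)
    qed
    have lim0: "(\<lambda>n. q ^ n * (vnorm X y / (1 - q))) \<longlonglongrightarrow> 0"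
      using q by (auto intro!: tendsto_mult_left_zero LIMSEQ_power_zero)
    have "\<forall>e>0. \<exists>N. \<forall>m\<ge>N. \<forall>n\<ge>N. vnorm X (\<sigma> m - \<sigma> n) < e"
    proof (intro allI impI)
      fix e :: real assume "e > 0"
      then obtain N where N: "\<And>n. n \<ge> N \<Longrightarrow> q ^ n * (vnorm X y / (1 - q)) < e"
        using order_tendstoD(2)[OF lim0] by (auto simp: eventually_sequentially)
      have "vnorm X (\<sigma> m - \<sigma> n) < e" if "m \<ge> N" "n \<ge> N" for m n
      proof (cases "n \<le> m")
        case True
        then show ?thesis using geo[of n "m - n"] N[OF that(2)] by simp
      next
        case False
        then show ?thesis using geo[of m "n - m"] N[OF that(1)] X.vnorm_diff_commute[OF \<sigma> \<sigma>, of m n] by simp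
      qed
      then show "\<exists>N. \<forall>m\<ge>N. \<forall>n\<ge>N. vnorm X (\<sigma> m - \<sigma> n) < e" by blast
    qed
    then obtain x where x: "x \<in> vcarrier X" and lim: "(\<lambda>n. vnorm X (\<sigma> n - x)) \<longlonglongrightarrow> 0"
      using X.complete_carrier[of \<sigma>] \<sigma> by blast
    obtain M where M: "M \<ge> 1" "\<And>x. x \<in> vcarrier X \<Longrightarrow> vnorm X (A x) \<le> M * vnorm X x"
      using bounded_operator_bound[OF A X] by blast
    have "vnorm X (A x - y) \<le> (M + 1) * vnorm X (\<sigma> n - x) + vnorm X (\<sigma> (Suc n) - x)" for n
    proof -
      have d: "\<sigma> n - x \<in> vcarrier X" "\<sigma> (Suc n) - x \<in> vcarrier X" using \<sigma> x X.carrier_diff by auto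
      have c: "A (\<sigma> n - x) \<in> vcarrier X" "\<sigma> n - x - A (\<sigma> n - x) \<in> vcarrier X"
        using d bounded_operatorD[OF A] X.carrier_diff by auto
      have eq: "A x - y = (\<sigma> n - x - A (\<sigma> n - x)) - (\<sigma> (Suc n) - x)"
        unfolding \<sigma>Suc bounded_operator_diff[OF A X \<sigma> x] by (simp add: algebra_simps)
      have "vnorm X (A x - y) \<le> vnorm X (\<sigma> n - x - A (\<sigma> n - x)) + vnorm X (\<sigma> (Suc n) - x)"
        unfolding eq by (rule X.vnorm_diff_le[OF c(2) d(2)])
      also have "vnorm X (\<sigma> n - x - A (\<sigma> n - x)) \<le> vnorm X (\<sigma> n - x) + vnorm X (A (\<sigma> n - x))"
        by (rule X.vnorm_diff_le[OF d(1) c(1)])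
      finally show ?thesis using M(2)[OF d(1)] unfolding distrib_right mult_1_left by linarith
    qed
    moreover have "(\<lambda>n. (M + 1) * vnorm X (\<sigma> n - x) + vnorm X (\<sigma> (Suc n) - x)) \<longlonglongrightarrow> (M + 1) * 0 + 0"
      by (intro tendsto_add tendsto_mult tendsto_const lim LIMSEQ_Suc[OF lim])
    ultimately have "vnorm X (A x - y) \<le> 0"
      by (intro LIMSEQ_le_const[of _ "0::real"]) auto
    moreover have "A x - y \<in> vcarrier X" using x y bounded_operatorD[OF A] X.carrier_diff by auto
    ultimately have "A x = y" using X.vnorm_eq_0_iff[of "A x - y"] X.vnorm_nonneg[of "A x - y"] by simp
    with x show ?thesis by blast
  qed
  define H where "H y = (SOME x. x \<in> vcarrier X \<and> A x = y)" for y
  have H: "H y \<in> vcarrier X" "A (H y) = y" if "y \<in> vcarrier X" for y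
    unfolding H_def using someI_ex[of "\<lambda>x. x \<in> vcarrier X \<and> A x = y"] surj[OF that] by blast+
  have "bounded_operator X X H"
    unfolding bounded_operator_def
  proof (intro conjI ballI allI exI)
    fix x y assume xy: "x \<in> vcarrier X" "y \<in> vcarrier X"
    show "H (x + y) = H x + H y"
    proof (rule inj)
      show "A (H (x + y)) = A (H x + H y)"
        unfolding bounded_operatorD(2)[OF A H(1)[OF xy(1)] H(1)[OF xy(2)]]
        by (simp only: H xy X.subspace_add[OF sub])
    qed (intro H X.subspace_add[OF sub] xy)+
  next
    fix c x assume x: "x \<in> vcarrier X"
    show "H (vscale X c x) = vscale X c (H x)"
    proof (rule inj)
      show "A (H (vscale X c x)) = A (vscale X c (H x))"
        unfolding bounded_operatorD(3)[OF A H(1)[OF x]]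
        by (simp only: H x X.subspace_scale[OF sub])
    qed (intro H X.subspace_scale[OF sub] x)+
  next
    fix y assume y: "y \<in> vcarrier X"
    show "vnorm X (H y) \<le> 1 / (1 - q) * vnorm X y"
    proof -
      have "(1 - q) * vnorm X (H y) \<le> vnorm X y" using below[OF H(1)[OF y]] unfolding H(2)[OF y] .
      then show ?thesis using q by (simp add: pos_le_divide_eq mult.commute)
    qed
  qed (use H in blast)
  then show thesis using that H(2) by blast
qed

section \<open>The space \<open>W p\<close> and its blocks\<close>

abbreviation block_norm :: "nat \<Rightarrow> (nat \<Rightarrow> 'k::real_normed_field) \<Rightarrow> real" where
  "block_norm j v \<equiv> vnorm (linf (Suc j)) v"

lemma linf_norm_le_iff:
  fixes v :: "nat \<Rightarrow> 'k::real_normed_field"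
  assumes "n \<ge> 1"
  shows "vnorm (linf n) v \<le> a \<longleftrightarrow> (\<forall>i<n. norm (v i) \<le> a)"
proof -
  have "{..<n} \<noteq> {}" using assms by (auto simp: lessThan_empty_iff)
  then show ?thesis by (auto simp: linf_def)
qed

lemma linf_coord_le:
  "i < n \<Longrightarrow> norm (v i) \<le> vnorm (linf n) (v :: nat \<Rightarrow> 'k::real_normed_field)"
  using linf_norm_le_iff[of n v "vnorm (linf n) v"] by simp

lemma linf_norm_nonneg: "n \<ge> 1 \<Longrightarrow> 0 \<le> vnorm (linf n) (v :: nat \<Rightarrow> 'k::real_normed_field)"
  using linf_coord_le[of 0 n v] by (meson norm_ge_zero order_trans less_le_trans zero_less_one)

lemma linf_norm_attained:
  fixes v :: "nat \<Rightarrow> 'k::real_normed_field"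
  assumes "n \<ge> 1"
  obtains i where "i < n" "vnorm (linf n) v = norm (v i)"
proof -
  have "Max ((\<lambda>i. norm (v i)) ` {..<n}) \<in> (\<lambda>i. norm (v i)) ` {..<n}"
    using assms by (intro Max_in) (auto simp: lessThan_empty_iff)
  then show ?thesis using that by (auto simp: linf_def)
qed

lemma block_norm_simps [simp]:
  "0 \<le> block_norm j v"
  "block_norm j (0 :: nat \<Rightarrow> 'k) = 0"
  "block_norm j (\<lambda>_. 0 :: 'k) = 0"
  for v :: "nat \<Rightarrow> 'k::real_normed_field"
proof -
  show "0 \<le> block_norm j v" by (simp add: linf_norm_nonneg)
  show "block_norm j (\<lambda>_. 0::'k) = 0"
    using linf_norm_le_iff[of "Suc j" "\<lambda>_. 0::'k" 0] linf_norm_nonneg[of "Suc j" "\<lambda>_. 0::'k"] by simp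
  then show "block_norm j (0 :: nat \<Rightarrow> 'k) = 0" by (simp add: zero_fun_def)
qed

lemma linf_carrier [simp]: "v \<in> vcarrier (linf n) \<longleftrightarrow> (\<forall>i\<ge>n. v i = 0)"
  and linf_scale [simp]: "vscale (linf n) c v = (\<lambda>i. c * v i)"
  by (auto simp: linf_def)

lemma sum_fun_apply: "(\<Sum>i\<in>I. f i) x = (\<Sum>i\<in>I. f i x)"
  for f :: "'i \<Rightarrow> 'a \<Rightarrow> 'b::comm_monoid_add"
  by (induction I rule: infinite_finite_induct) simp_all

lemma W_carrier_iff:
  "x \<in> vcarrier (W p) \<longleftrightarrow>
     (\<forall>j i. j < i \<longrightarrow> x j i = 0) \<and> summable (\<lambda>j. block_norm j (x j) powr p)"
  by (auto simp: W_def lp_sum_def linf_def Suc_le_eq)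

lemma W_scale [simp]: "vscale (W p) c x = (\<lambda>j i. c * x j i)"
  by (simp add: W_def lp_sum_def linf_def)

lemma W_norm: "vnorm (W p) x = (\<Sum>j. block_norm j (x j) powr p) powr (1 / p)"
  by (simp add: W_def lp_sum_def)

lemma W_norm_nonneg [simp]: "0 \<le> vnorm (W p) x"
  by (simp add: W_norm)

lemma W_sum_le_norm_powr:
  assumes "p > 1" "x \<in> vcarrier (W p)" "finite A"
  shows "(\<Sum>j\<in>A. block_norm j (x j) powr p) \<le> vnorm (W p) x powr p"
proof -
  have s: "summable (\<lambda>j. block_norm j (x j) powr p)" using assms by (simp add: W_carrier_iff)
  have "(\<Sum>j\<in>A. block_norm j (x j) powr p) \<le> (\<Sum>j. block_norm j (x j) powr p)"
    using s assms by (intro sum_le_suminf) auto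
  then show ?thesis using assms s by (simp add: W_norm powr_powr suminf_nonneg)
qed

lemma block_norm_le_W_norm:
  assumes "p > 1" "x \<in> vcarrier (W p)"
  shows "block_norm j (x j) \<le> vnorm (W p) x"
proof -
  have "block_norm j (x j) powr p \<le> vnorm (W p) x powr p"
    using W_sum_le_norm_powr[OF assms, of "{j}"] by simp
  then show ?thesis using assms
    by (metis block_norm_simps(1) W_norm_nonneg not_le powr_less_mono2 less_trans zero_less_one)
qed

lemma coord_le_W_norm:
  assumes "p > 1" "x \<in> vcarrier (W p)"
  shows "norm (x j i) \<le> vnorm (W p) x"
proof (cases "i \<le> j")
  case True
  then show ?thesis using linf_coord_le[of i "Suc j" "x j"] block_norm_le_W_norm[OF assms, of j] by simp
next
  case False
  then show ?thesis using assms by (simp add: W_carrier_iff)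
qed

text \<open>
  A bound on partial sums yields membership as well as the norm estimate. Partial sums along a
  subsequence are convenient for vectors that are estimated one window of summands at a time.
\<close>

lemma W_boundI:
  assumes p: "p > 1" and "K \<ge> 0" and z: "\<And>j i. j < i \<Longrightarrow> x j i = 0"
    and m: "strict_mono (m :: nat \<Rightarrow> nat)"
    and b: "\<And>L. (\<Sum>j<m L. block_norm j (x j) powr p) \<le> K powr p"
  shows "x \<in> vcarrier (W p)" "vnorm (W p) x \<le> K"
proof -
  have b': "(\<Sum>j<L. block_norm j (x j) powr p) \<le> K powr p" for L
    using strict_mono_imp_increasing[OF m, of L]
    by (intro order_trans[OF sum_mono2 b[of L]]) auto
  have s: "summable (\<lambda>j. block_norm j (x j) powr p)"
    by (rule bounded_imp_summable[where B = "K powr p"])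
       (use b'[of "Suc _"] in \<open>auto simp: lessThan_Suc_atMost\<close>)
  then show "x \<in> vcarrier (W p)" using z by (simp add: W_carrier_iff)
  have "(\<Sum>j. block_norm j (x j) powr p) powr (1 / p) \<le> (K powr p) powr (1 / p)"
    using p s b' by (intro powr_mono2 suminf_nonneg suminf_le_const) auto
  then show "vnorm (W p) x \<le> K" using assms by (simp add: W_norm powr_powr)
qed

lemma W_dominated:
  assumes p: "p > 1" and x: "x \<in> vcarrier (W p)" and z: "\<And>j i. j < i \<Longrightarrow> y j i = 0"
    and le: "\<And>j. block_norm j (y j) \<le> block_norm j (x j)"
  shows "y \<in> vcarrier (W p)" "vnorm (W p) y \<le> vnorm (W p) x"
proof -
  have "(\<Sum>j<id L. block_norm j (y j) powr p) \<le> vnorm (W p) x powr p" for L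
  proof -
    have "(\<Sum>j<L. block_norm j (y j) powr p) \<le> (\<Sum>j<L. block_norm j (x j) powr p)"
      using p le by (intro sum_mono powr_mono2) auto
    then show ?thesis using W_sum_le_norm_powr[OF p x, of "{..<L}"] by simp
  qed
  from W_boundI[OF p _ z _ this] show "y \<in> vcarrier (W p)" "vnorm (W p) y \<le> vnorm (W p) x"
    by (auto simp: strict_mono_def)
qed

definition restrict_blocks :: "nat set \<Rightarrow> (nat \<Rightarrow> nat \<Rightarrow> 'k) \<Rightarrow> nat \<Rightarrow> nat \<Rightarrow> 'k::zero" where
  "restrict_blocks A x = (\<lambda>j i. if j \<in> A then x j i else 0)"

lemma block_norm_restrict:
  "block_norm j (restrict_blocks A x j) = (if j \<in> A then block_norm j (x j) else 0)"
  for x :: "nat \<Rightarrow> nat \<Rightarrow> 'k::real_normed_field"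
  by (simp add: restrict_blocks_def)

lemma restrict_blocks_W:
  assumes "p > 1" "x \<in> vcarrier (W p)"
  shows "restrict_blocks A x \<in> vcarrier (W p)" "vnorm (W p) (restrict_blocks A x) \<le> vnorm (W p) x"
proof -
  have "restrict_blocks A x j i = 0" if "j < i" for j i
    using assms(2) that by (simp add: W_carrier_iff restrict_blocks_def)
  from W_dominated[OF assms this]
  show "restrict_blocks A x \<in> vcarrier (W p)" "vnorm (W p) (restrict_blocks A x) \<le> vnorm (W p) x"
    by (auto simp: block_norm_restrict)
qed

lemma restrict_blocks_split: "restrict_blocks A x + restrict_blocks (- A) x = x"
  for x :: "nat \<Rightarrow> nat \<Rightarrow> 'k::real_normed_field"
  by (auto simp: restrict_blocks_def fun_eq_iff)

lemma restrict_blocks_diff: "restrict_blocks A (x - y) = restrict_blocks A x - restrict_blocks A y"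
  for x y :: "nat \<Rightarrow> nat \<Rightarrow> 'k::real_normed_field"
  by (auto simp: restrict_blocks_def fun_eq_iff)

lemma restrict_blocks_sum:
  "restrict_blocks A (\<Sum>i\<in>I. vscale (W p) (c i) (x i)) = (\<Sum>i\<in>I. vscale (W p) (c i) (restrict_blocks A (x i)))"
  by (auto simp: restrict_blocks_def fun_eq_iff sum_fun_apply)

lemma W_norm_restrict_finite:
  fixes x :: "nat \<Rightarrow> nat \<Rightarrow> 'k::real_normed_field"
  assumes "finite A"
  shows "vnorm (W p) (restrict_blocks A x) = (\<Sum>j\<in>A. block_norm j (x j) powr p) powr (1 / p)"
proof -
  have "(\<Sum>j. block_norm j (restrict_blocks A x j) powr p) = (\<Sum>j\<in>A. block_norm j (restrict_blocks A x j) powr p)"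
    using assms by (intro suminf_finite) (auto simp: block_norm_restrict)
  also have "\<dots> = (\<Sum>j\<in>A. block_norm j (x j) powr p)"
    by (intro sum.cong) (auto simp: block_norm_restrict)
  finally show ?thesis by (simp add: W_norm)
qed

definition single_block :: "nat \<Rightarrow> (nat \<Rightarrow> 'k) \<Rightarrow> nat \<Rightarrow> nat \<Rightarrow> 'k::zero" where
  "single_block l v = (\<lambda>j. if j = l then v else (\<lambda>_. 0))"

lemma single_block_in_W:
  fixes v :: "nat \<Rightarrow> 'k::real_normed_field"
  assumes "v \<in> vcarrier (linf (Suc l))"
  shows "single_block l v \<in> vcarrier (W p)"
proof -
  have "summable (\<lambda>j. block_norm j (single_block l v j) powr p)"
    by (rule summable_finite[of "{l}"]) (auto simp: single_block_def)
  then show ?thesis using assms unfolding W_carrier_iff by (auto simp: single_block_def)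
qed

lemma W_norm_single_block:
  fixes x :: "nat \<Rightarrow> nat \<Rightarrow> 'k::real_normed_field"
  assumes "p > 1" "\<And>j. j \<noteq> l \<Longrightarrow> x j = (\<lambda>_. 0)"
  shows "vnorm (W p) x = block_norm l (x l)"
proof -
  have "x = restrict_blocks {l} x" using assms(2) by (auto simp: restrict_blocks_def fun_eq_iff)
  then have "vnorm (W p) x = vnorm (W p) (restrict_blocks {l} x)" by simp
  also have "\<dots> = block_norm l (x l)" using assms(1) by (simp add: W_norm_restrict_finite powr_powr)
  finally show ?thesis .
qed

lemma W_tail_tendsto_0:
  assumes p: "p > 1" and x: "x \<in> vcarrier (W p)"
  shows "(\<lambda>b. vnorm (W p) (restrict_blocks {b..} x)) \<longlonglongrightarrow> 0"
proof -
  let ?g = "\<lambda>j. block_norm j (x j) powr p"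
  have s: "summable ?g" using x by (simp add: W_carrier_iff)
  have eq: "vnorm (W p) (restrict_blocks {b..} x) = ((\<Sum>j. ?g j) - (\<Sum>j<b. ?g j)) powr (1 / p)" for b
  proof -
    have "(\<lambda>j. ?g j - (if j \<in> {..<b} then ?g j else 0)) sums ((\<Sum>j. ?g j) - (\<Sum>j<b. ?g j))"
      using s by (intro sums_diff summable_sums sums_If_finite_set) auto
    also have "(\<lambda>j. ?g j - (if j \<in> {..<b} then ?g j else 0)) =
        (\<lambda>j. block_norm j (restrict_blocks {b..} x j) powr p)"
      using p by (auto simp: block_norm_restrict)
    finally show ?thesis by (simp add: W_norm sums_iff)
  qed
  have "(\<lambda>b. (\<Sum>j. ?g j) - (\<Sum>j<b. ?g j)) \<longlonglongrightarrow> (\<Sum>j. ?g j) - (\<Sum>j. ?g j)"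
    using s by (intro tendsto_diff tendsto_const summable_LIMSEQ)
  then have "(\<lambda>b. ((\<Sum>j. ?g j) - (\<Sum>j<b. ?g j)) powr (1 / p)) \<longlonglongrightarrow> 0 powr (1 / p)"
    using p s by (intro tendsto_powr') (auto intro!: always_eventually sum_le_suminf)
  then show ?thesis by (simp add: eq)
qed

text \<open>
  The head is estimated by coordinates because coordinates are linear functionals, to which
  \<open>sum_functional_basis_le\<close> below applies; the loss of a constant depending on \<open>m\<close> is harmless.
\<close>

lemma W_norm_head_le:
  fixes x :: "nat \<Rightarrow> nat \<Rightarrow> 'k::{real_normed_field,banach}"
  assumes p: "p > 1" and x: "x \<in> vcarrier (W p)"
  shows "vnorm (W p) (restrict_blocks {..<m} x) \<le> (\<Sum>j<m. \<Sum>i\<le>j. norm (x j i))"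
proof -
  interpret W: banach_space "W p :: ('k, nat \<Rightarrow> nat \<Rightarrow> 'k) nspace" using p by (intro banach_space_W) simp
  show ?thesis
  proof (induction m)
    case 0
    show ?case by (simp add: W_norm_restrict_finite)
  next
    case (Suc m)
    have "restrict_blocks {..<Suc m} x = restrict_blocks {..<m} x + restrict_blocks {m} x"
      by (auto simp: restrict_blocks_def fun_eq_iff less_Suc_eq)
    then have "vnorm (W p) (restrict_blocks {..<Suc m} x) \<le>
        vnorm (W p) (restrict_blocks {..<m} x) + vnorm (W p) (restrict_blocks {m} x)"
      using W.vnorm_triangle restrict_blocks_W[OF p x] by metis
    moreover have "vnorm (W p) (restrict_blocks {m} x) = block_norm m (x m)"
      using p by (simp add: W_norm_restrict_finite powr_powr)
    moreover have "block_norm m (x m) \<le> (\<Sum>i\<le>m. norm (x m i))"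
      by (subst linf_norm_le_iff) (auto intro!: member_le_sum)
    ultimately show ?case using Suc.IH by simp
  qed
qed

section \<open>Functionals on \<open>W p\<close>\<close>

text \<open>
  The functionals in use are finite combinations of coordinates, so they are linear on all double
  sequences, without reference to the carrier of \<open>W p\<close>.
\<close>

definition linear_functional :: "((nat \<Rightarrow> nat \<Rightarrow> 'k::real_normed_field) \<Rightarrow> 'k) \<Rightarrow> bool" where
  "linear_functional f \<longleftrightarrow>
     (\<forall>x y. f (x + y) = f x + f y) \<and> (\<forall>c x. f (\<lambda>j i. c * x j i) = c * f x)"

lemma linear_functional_diff:
  assumes f: "linear_functional f"
  shows "f (x - y) = f x - f y"
proof -
  have "f (x - y + y) = f (x - y) + f y" using f unfolding linear_functional_def by blast
  then show ?thesis by simp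
qed

lemma linear_functional_sum:
  assumes f: "linear_functional f" and "finite I"
  shows "f (\<Sum>i\<in>I. vscale (W p) (c i) (x i)) = (\<Sum>i\<in>I. c i * f (x i))"
proof -
  have add: "f (u + v) = f u + f v" and sc: "f (vscale (W p) d u) = d * f u" for u v d
    using f unfolding linear_functional_def W_scale by blast+
  have f0: "f 0 = 0" using add[of 0 0] by simp
  show ?thesis using \<open>finite I\<close>
  proof (induction I rule: finite_induct)
    case empty
    then show ?case using f0 by (simp only: sum.empty)
  next
    case (insert i I)
    show ?case by (simp only: sum.insert[OF insert.hyps] insert.IH add sc)
  qed
qed

text \<open>
  The inequality of Hoelder with one factor normalized; the exponent \<open>p - 1\<close> turns the unit vector
  \<open>u\<close> of \<open>\<ell>\<^sub>p\<close> into its norming functional.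
\<close>

lemma Holder_normalized:
  fixes u v :: "'i \<Rightarrow> real"
  assumes p: "p > 1" and A: "finite A"
    and u: "\<And>j. j \<in> A \<Longrightarrow> u j \<ge> 0" and v: "\<And>j. j \<in> A \<Longrightarrow> v j \<ge> 0"
    and 1: "(\<Sum>j\<in>A. u j powr p) = 1"
  shows "(\<Sum>j\<in>A. u j powr (p - 1) * v j) \<le> (\<Sum>j\<in>A. v j powr p) powr (1 / p)"
proof -
  define s where "s = (\<Sum>j\<in>A. v j powr p) powr (1 / p)"
  have sp: "s powr p = (\<Sum>j\<in>A. v j powr p)" using p by (simp add: s_def powr_powr sum_nonneg)
  have "s \<ge> 0" by (simp add: s_def)
  show ?thesis
  proof (cases "s = 0")
    case True
    then have "(\<Sum>j\<in>A. v j powr p) = 0" using sp p by simp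
    then have "v j = 0" if "j \<in> A" for j using that A by (simp add: sum_nonneg_eq_0_iff)
    then show ?thesis by simp
  next
    case False
    with \<open>s \<ge> 0\<close> have s: "s > 0" by simp
    define q where "q = p / (p - 1)"
    have q: "q > 1" "1 / q + 1 / p = 1" "(p - 1) * q = p"
      using p by (auto simp: q_def field_simps)
    have "(\<Sum>j\<in>A. u j powr (p - 1) * (v j / s)) \<le> (\<Sum>j\<in>A. u j powr p / q + v j powr p / s powr p / p)"
    proof (rule sum_mono)
      fix j assume "j \<in> A"
      then show "u j powr (p - 1) * (v j / s) \<le> u j powr p / q + v j powr p / s powr p / p"
        using Youngs_inequality[of q p "u j powr (p - 1)" "v j / s"] p q s v[of j]
        by (simp add: powr_powr powr_divide)
    qed
    also have "\<dots> = (\<Sum>j\<in>A. u j powr p) / q + (\<Sum>j\<in>A. v j powr p) / s powr p / p"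
      by (simp add: sum.distrib sum_divide_distrib)
    also have "\<dots> = 1" using s 1 q(2) by (simp flip: sp)
    finally have "(\<Sum>j\<in>A. u j powr (p - 1) * v j) / s \<le> 1"
      by (simp add: sum_divide_distrib)
    then show ?thesis using s by (simp add: s_def[symmetric])
  qed
qed

text \<open>
  The functional that norms a vector of an \<open>\<ell>\<^sub>p\<close>-sum is explicit: norm each summand by its largest
  coordinate and weight the summands by the \<open>p - 1\<close>-st powers of their norms. Scaled to value 1 at
  \<open>z\<close>, it sees only the blocks in \<open>A\<close>.
\<close>

lemma norming_functional:
  fixes z :: "nat \<Rightarrow> nat \<Rightarrow> 'k::real_normed_field"
  assumes p: "p > 1" and A: "finite A" and z: "vnorm (W p) (restrict_blocks A z) > 0"
  obtains f where "linear_functional f" "f z = 1"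
    "\<And>w. norm (f w) \<le> vnorm (W p) (restrict_blocks A w) / vnorm (W p) (restrict_blocks A z)"
proof -
  define \<nu> where "\<nu> = vnorm (W p) (restrict_blocks A z)"
  have \<nu>: "\<nu> > 0" using z by (simp add: \<nu>_def)
  have \<nu>p: "\<nu> powr p = (\<Sum>j\<in>A. block_norm j (z j) powr p)"
    using p A by (simp add: \<nu>_def W_norm_restrict_finite powr_powr sum_nonneg)
  have "\<exists>t. \<forall>j. t j < Suc j \<and> block_norm j (z j) = norm (z j (t j))"
    by (rule choice) (metis linf_norm_attained le_add1 plus_1_eq_Suc)
  then obtain t where t: "t j < Suc j" "block_norm j (z j) = norm (z j (t j))" for j by blast
  define u where "u j = block_norm j (z j) / \<nu>" for j
  have u0: "u j \<ge> 0" for j using \<nu> by (simp add: u_def)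
  have u1: "(\<Sum>j\<in>A. u j powr p) = 1"
  proof -
    have "(\<Sum>j\<in>A. u j powr p) = (\<Sum>j\<in>A. block_norm j (z j) powr p) / \<nu> powr p"
      using \<nu> by (simp add: u_def powr_divide sum_divide_distrib)
    then show ?thesis using \<nu> by (simp add: \<nu>p[symmetric])
  qed
  \<comment> \<open>rotates the largest coordinate of \<open>z j\<close> to a nonnegative real; 0 if that coordinate is 0\<close>
  define s where "s j = of_real (norm (z j (t j))) / z j (t j)" for j
  have s1: "norm (s j) \<le> 1" for j by (simp add: s_def norm_divide)
  have sz: "s j * z j (t j) = of_real (block_norm j (z j))" for j by (simp add: s_def t(2))
  define f where "f w = (\<Sum>j\<in>A. of_real (u j powr (p - 1) / \<nu>) * s j * w j (t j))" for w
  show thesis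
  proof
    show "linear_functional f"
      by (simp add: linear_functional_def f_def distrib_left add_divide_distrib sum.distrib sum_distrib_left mult_ac)
    have "f z = (\<Sum>j\<in>A. of_real (u j powr p))"
      unfolding f_def
    proof (rule sum.cong)
      fix j
      have "u j powr (p - 1) / \<nu> * block_norm j (z j) = u j powr (p - 1) * u j powr 1"
        using u0[of j] \<nu> by (simp add: u_def)
      also have "\<dots> = u j powr p" unfolding powr_add[symmetric] by simp
      finally show "of_real (u j powr (p - 1) / \<nu>) * s j * z j (t j) = (of_real (u j powr p) :: 'k)"
        by (metis mult.assoc of_real_mult sz)
    qed simp
    also have "\<dots> = 1" using u1 by (simp flip: of_real_sum)
    finally show "f z = 1" .
    fix w :: "nat \<Rightarrow> nat \<Rightarrow> 'k"
    have "norm (f w) \<le> (\<Sum>j\<in>A. u j powr (p - 1) / \<nu> * block_norm j (w j))"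
      unfolding f_def
    proof (rule sum_norm_le)
      fix j
      have "norm (s j) * norm (w j (t j)) \<le> 1 * block_norm j (w j)"
        using s1 linf_coord_le[OF t(1)] by (intro mult_mono) auto
      then show "norm (of_real (u j powr (p - 1) / \<nu>) * s j * w j (t j)) \<le> u j powr (p - 1) / \<nu> * block_norm j (w j)"
        using \<nu> mult_left_mono[of "norm (s j) * norm (w j (t j))" "block_norm j (w j)" "u j powr (p - 1) / \<nu>"]
        by (simp add: norm_mult norm_divide mult.assoc)
    qed
    also have "\<dots> = (\<Sum>j\<in>A. u j powr (p - 1) * block_norm j (w j)) / \<nu>"
      by (simp add: sum_divide_distrib)
    also have "\<dots> \<le> vnorm (W p) (restrict_blocks A w) / \<nu>"
      using Holder_normalized[OF p A _ _ u1, of "\<lambda>j. block_norm j (w j)"] u0 \<nu> A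
      by (intro divide_right_mono) (auto simp: W_norm_restrict_finite)
    finally show "norm (f w) \<le> vnorm (W p) (restrict_blocks A w) / vnorm (W p) (restrict_blocks A z)"
      by (simp add: \<nu>_def)
  qed
qed

definition basis_vec :: "nat \<Rightarrow> nat \<Rightarrow> 'k::zero_neq_one" where
  "basis_vec i = (\<lambda>t. if t = i then 1 else 0)"

text \<open>
  The functional \<open>f \<circ> U\<close> on \<open>\<ell>\<^sub>\<infinity>\<^sup>N\<close> has \<open>\<ell>\<^sub>1\<close>-norm at most \<open>K * c\<close>: evaluate it at the vector of
  signs of its coefficients. The essential feature is that the bound is independent of \<open>N\<close>.
\<close>

lemma sum_functional_basis_le:
  fixes U :: "(nat \<Rightarrow> 'k) \<Rightarrow> nat \<Rightarrow> nat \<Rightarrow> 'k::{real_normed_field,banach}"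
  assumes p: "p > 1" and N: "N \<ge> 1" and U: "bounded_operator (linf N) (W p) U"
    and Uc: "\<And>v. v \<in> vcarrier (linf N) \<Longrightarrow> vnorm (W p) (U v) \<le> c * vnorm (linf N) v"
    and f: "linear_functional f" and K: "K \<ge> 0"
    and fK: "\<And>w. w \<in> vcarrier (W p) \<Longrightarrow> norm (f w) \<le> K * vnorm (W p) w"
  shows "(\<Sum>i<N. norm (f (U (basis_vec i)))) \<le> K * c"
proof -
  note BX = banach_space_linf[OF N, where 'k='k]
  define a where "a i = f (U (basis_vec i))" for i
  define s where "s i = of_real (norm (a i)) / a i" for i
  have s1: "norm (s i) \<le> 1" and sa: "s i * a i = of_real (norm (a i))" for i
    by (auto simp: s_def norm_divide)
  let ?v = "\<Sum>i<N. vscale (linf N) (s i) (basis_vec i)"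
  have e: "basis_vec i \<in> vcarrier (linf N)" if "i \<in> {..<N}" for i using that by (auto simp: basis_vec_def)
  have v: "?v \<in> vcarrier (linf N)" and Uv: "U ?v = (\<Sum>i<N. vscale (W p) (s i) (U (basis_vec i)))"
    using bounded_operator_sum[OF U BX _ e, where I = "{..<N}" and c = s] by auto
  have "?v t = (if t < N then s t else 0)" for t
    by (simp add: sum_fun_apply basis_vec_def if_distrib[of "(*) _"] cong: if_cong)
  then have v1: "vnorm (linf N) ?v \<le> 1" using s1 N by (simp add: linf_norm_le_iff)
  have v0: "0 \<le> vnorm (linf N) ?v" using N by (rule linf_norm_nonneg)
  have "0 \<le> c * vnorm (linf N) (basis_vec 0 :: nat \<Rightarrow> 'k)"
    using Uc[of "basis_vec 0"] e[of 0] N by (meson W_norm_nonneg lessThan_iff order_trans less_le_trans zero_less_one)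
  moreover have "vnorm (linf N) (basis_vec 0 :: nat \<Rightarrow> 'k) > 0"
    using linf_coord_le[of 0 N "basis_vec 0 :: nat \<Rightarrow> 'k"] N by (simp add: basis_vec_def)
  ultimately have c: "c \<ge> 0" by (simp add: zero_le_mult_iff)
  have "(\<Sum>i<N. norm (a i)) = norm (f (U ?v))"
  proof -
    have "f (U ?v) = (\<Sum>i<N. of_real (norm (a i)))"
      unfolding Uv by (subst linear_functional_sum[OF f]) (simp_all add: sa flip: a_def)
    then show ?thesis by (simp flip: of_real_sum add: sum_nonneg)
  qed
  also have "\<dots> \<le> K * vnorm (W p) (U ?v)" by (rule fK) (rule bounded_operatorD(1)[OF U v])
  also have "\<dots> \<le> K * (c * 1)"
    using Uc[OF v] mult_left_mono[OF v1 c] K by (intro mult_left_mono) auto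
  finally show ?thesis by (simp add: a_def)
qed

section \<open>Selecting well-separated indices\<close>

text \<open>
  Greedy choice: the average in-degree is at most \<open>D\<close>, so some vertex has at most \<open>2 * D\<close> in- and
  out-neighbours in total, and choosing it costs at most \<open>2 * D + 1\<close> vertices.
\<close>

lemma digraph_independent_set:
  fixes r :: "'a \<Rightarrow> 'a \<Rightarrow> bool"
  assumes "finite V" "\<And>i. i \<in> V \<Longrightarrow> card {j\<in>V. r i j} \<le> D" "n * (2 * D + 1) \<le> card V"
  shows "\<exists>A\<subseteq>V. card A = n \<and> (\<forall>i\<in>A. \<forall>j\<in>A. i \<noteq> j \<longrightarrow> \<not> r i j)"
  using assms
proof (induction n arbitrary: V)
  case 0
  then show ?case by (intro exI[of _ "{}"]) auto
next
  case (Suc n)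
  note fin [simp] = \<open>finite V\<close>
  have "(\<Sum>j\<in>V. card {i\<in>V. r i j}) = (\<Sum>i\<in>V. card {j\<in>V. r i j})"
    by (simp only: card_eq_sum sum.inter_filter fin) (rule sum.swap)
  also have "\<dots> \<le> D * card V" using sum_bounded_above[of V _ D] Suc.prems(2) by (simp add: mult.commute)
  finally have "\<exists>k\<in>V. card {i\<in>V. r i k} \<le> D"
    using sum_bounded_below[of V "Suc D" "\<lambda>j. card {i\<in>V. r i j}"] Suc.prems(3)
    by (auto simp: not_le Suc_le_eq[symmetric] mult.commute dest: order_trans intro: ccontr)
  then obtain k where k: "k \<in> V" "card {i\<in>V. r i k} \<le> D" by blast
  define V' where "V' = V - ({k} \<union> {i\<in>V. r i k} \<union> {j\<in>V. r k j})"
  have "card ({k} \<union> {i\<in>V. r i k} \<union> {j\<in>V. r k j}) \<le> 1 + D + D"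
    using card_Un_le[of "{k} \<union> {i\<in>V. r i k}" "{j\<in>V. r k j}"] card_Un_le[of "{k}" "{i\<in>V. r i k}"]
      k(2) Suc.prems(2)[OF k(1)] by simp
  then have "n * (2 * D + 1) \<le> card V'"
    unfolding V'_def using Suc.prems(3)
    by (subst card_Diff_subset) (auto simp: k)
  moreover have "card {j\<in>V'. r i j} \<le> D" if "i \<in> V'" for i
  proof -
    have "card {j\<in>V'. r i j} \<le> card {j\<in>V. r i j}" by (intro card_mono) (auto simp: V'_def)
    then show ?thesis using Suc.prems(2)[of i] that by (auto simp: V'_def)
  qed
  ultimately obtain A where A: "A \<subseteq> V'" "card A = n" "\<forall>i\<in>A. \<forall>j\<in>A. i \<noteq> j \<longrightarrow> \<not> r i j"
    using Suc.IH[of V'] by (auto simp: V'_def)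
  have "finite A" using A(1) finite_subset[of A V] by (auto simp: V'_def)
  moreover have "k \<notin> A" using A(1) by (auto simp: V'_def)
  ultimately have "card (insert k A) = Suc n" using A by simp
  moreover have "insert k A \<subseteq> V" using A(1) k by (auto simp: V'_def)
  moreover have "\<forall>i\<in>insert k A. \<forall>j\<in>insert k A. i \<noteq> j \<longrightarrow> \<not> r i j"
    using A(1,3) by (auto simp: V'_def)
  ultimately show ?case by blast
qed

lemma card_large_values:
  fixes g :: "'a \<Rightarrow> real"
  assumes "finite I" "\<And>i. i \<in> I \<Longrightarrow> 0 \<le> g i" "(\<Sum>i\<in>I. g i) \<le> K" "\<eta> > 0"
  shows "card {i\<in>I. g i > \<eta>} \<le> nat \<lfloor>K / \<eta>\<rfloor>"
proof -
  have "of_nat (card {i\<in>I. g i > \<eta>}) * \<eta> \<le> (\<Sum>i\<in>{i\<in>I. g i > \<eta>}. g i)"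
    by (rule sum_bounded_below) simp
  also have "\<dots> \<le> (\<Sum>i\<in>I. g i)" using assms by (intro sum_mono2) auto
  finally have "real (card {i\<in>I. g i > \<eta>}) \<le> K / \<eta>"
    using assms by (simp add: field_simps)
  then show ?thesis by linarith
qed

section \<open>Almost biorthogonal blocks\<close>

text \<open>
  Vectors \<open>X i\<close> supported in the set \<open>B\<close> of blocks that span a \<open>C\<close>-bounded image of \<open>\<ell>\<^sub>\<infinity>\<^sup>n\<close>, with
  functionals \<open>F i\<close> that depend on the blocks in \<open>B\<close> alone and are, up to \<open>\<delta>\<close>, biorthogonal to the
  images \<open>T (X i)\<close>; these images are concentrated on \<open>B\<close> up to \<open>\<delta>\<close>. The constant \<open>2 * C\<close> for the
  functionals allows for images of norm \<open>1 / C\<close> that lose half of their norm when cut down to \<open>B\<close>.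
\<close>

definition almost_dual_block ::
  "real \<Rightarrow> ((nat \<Rightarrow> nat \<Rightarrow> 'k) \<Rightarrow> nat \<Rightarrow> nat \<Rightarrow> 'k::real_normed_field) \<Rightarrow> real \<Rightarrow> real \<Rightarrow> nat \<Rightarrow> nat set \<Rightarrow>
     (nat \<Rightarrow> nat \<Rightarrow> nat \<Rightarrow> 'k) \<Rightarrow> (nat \<Rightarrow> (nat \<Rightarrow> nat \<Rightarrow> 'k) \<Rightarrow> 'k) \<Rightarrow> bool" where
  "almost_dual_block p T C \<delta> n B X F \<longleftrightarrow>
     (\<forall>i<n. X i \<in> vcarrier (W p) \<and> restrict_blocks B (X i) = X i) \<and>
     (\<forall>v. vnorm (W p) (\<Sum>i<n. vscale (W p) (v i) (X i)) \<le> C * vnorm (linf n) v) \<and>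
     (\<forall>i<n. linear_functional (F i) \<and> (\<forall>w. norm (F i w) \<le> 2 * C * vnorm (W p) (restrict_blocks B w))) \<and>
     (\<forall>i<n. \<forall>k<n. norm (F i (T (X k)) - (if i = k then 1 else 0)) \<le> \<delta>) \<and>
     (\<forall>i<n. vnorm (W p) (restrict_blocks (- B) (T (X i))) \<le> \<delta>)"

text \<open>
  The heart of the proof: from a copy of \<open>\<ell>\<^sub>\<infinity>\<^sup>N\<close> with \<open>N\<close> large, discard the few unit vectors whose
  images are not small on the first \<open>m\<close> blocks, cut off a tail, and pass to an independent
  set for the relation ``the functional norming \<open>y i\<close> is not small at \<open>y k\<close>''.
\<close>

lemma almost_dual_block_exists:
  fixes T :: "(nat \<Rightarrow> nat \<Rightarrow> 'k) \<Rightarrow> nat \<Rightarrow> nat \<Rightarrow> 'k::{real_normed_field,banach}"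
  assumes p: "p > 1" and T: "bounded_operator (W p) (W p) T" and C: "C \<ge> 1" and \<delta>: "\<delta> > 0"
    and fix_copies: "\<And>N. N \<ge> 1 \<Longrightarrow> fixes_copy C (W p) (W p) T (linf N :: ('k, nat \<Rightarrow> 'k) nspace)"
    and n: "n \<ge> 1"
  shows "\<exists>m' X F. m < m' \<and> almost_dual_block p T C \<delta> n {m..<m'} X F"
proof -
  have BW: "banach_space (W p :: ('k, nat \<Rightarrow> nat \<Rightarrow> 'k) nspace)" using p by (intro banach_space_W) simp
  interpret W: banach_space "W p :: ('k, nat \<Rightarrow> nat \<Rightarrow> 'k) nspace" by (rule BW)
  note rW = restrict_blocks_W[OF p]
  obtain M where M: "M \<ge> 1" "\<And>x. x \<in> vcarrier (W p) \<Longrightarrow> vnorm (W p) (T x) \<le> M * vnorm (W p) x"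
    using bounded_operator_bound[OF T BW] by blast
  \<comment> \<open>all errors below are at most \<open>K * \<eta>\<close>\<close>
  define K where "K = 2 + 4 * C * M"
  have "C * M \<ge> 1 * 1" using C M by (intro mult_mono) auto
  then have K: "K > 0" by (simp add: K_def)
  define \<eta> where "\<eta> = min (1 / (4 * C)) (\<delta> / K)"
  have \<eta>: "\<eta> > 0" "\<eta> \<le> 1 / (4 * C)" "K * \<eta> \<le> \<delta>"
    using C K \<delta> by (auto simp: \<eta>_def min_def field_simps)
  \<comment> \<open>out-degree bound, and number of vectors with a large head; neither depends on \<open>N\<close>\<close>
  define D where "D = nat \<lfloor>(2 * C) * (M * C) / \<eta>\<rfloor>"
  define D1 where "D1 = nat \<lfloor>(\<Sum>j<m. \<Sum>t\<le>j. C + M * C) / \<eta>\<rfloor>"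
  define N where "N = Suc (D1 + n * (2 * D + 1))"
  have N: "N \<ge> 1" by (simp add: N_def)
  note BN = banach_space_linf[OF N, where 'k='k]
  obtain S :: "(nat \<Rightarrow> 'k) \<Rightarrow> nat \<Rightarrow> nat \<Rightarrow> 'k" where S: "bounded_operator (linf N) (W p) S"
    and Sn: "operator_norm (linf N) (W p) S \<le> C"
    and Sb: "bounded_below_by (linf N) (W p) (T \<circ> S) (1 / C)"
    using fix_copies[OF N] unfolding fixes_copy_def by blast
  have S_le: "vnorm (W p) (S v) \<le> C * vnorm (linf N) v" if "v \<in> vcarrier (linf N)" for v
    using operator_norm_le_imp[OF S BN BW Sn that] .
  have U: "bounded_operator (linf N) (W p) (T \<circ> S)" by (rule bounded_operator_comp[OF S T BN BW])
  have U_le: "vnorm (W p) ((T \<circ> S) v) \<le> M * C * vnorm (linf N) v" if v: "v \<in> vcarrier (linf N)" for v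
  proof -
    have "vnorm (W p) (T (S v)) \<le> M * vnorm (W p) (S v)" by (rule M(2)[OF bounded_operatorD(1)[OF S v]])
    also have "\<dots> \<le> M * (C * vnorm (linf N) v)" using S_le[OF v] M by (intro mult_left_mono) auto
    finally show ?thesis by (simp add: mult.assoc)
  qed
  define x where "x i = S (basis_vec i)" for i
  define y where "y i = T (x i)" for i
  have e: "basis_vec i \<in> vcarrier (linf N)" if "i < N" for i using that by (auto simp: basis_vec_def)
  have x: "x i \<in> vcarrier (W p)" if "i < N" for i using bounded_operatorD(1)[OF S e[OF that]] by (simp add: x_def)
  have y: "y i \<in> vcarrier (W p)" if "i < N" for i using bounded_operatorD(1)[OF T x[OF that]] by (simp add: y_def)
  have y_norm: "vnorm (W p) (y i) \<ge> 1 / C" if i: "i < N" for i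
  proof -
    have "1 / C * 1 \<le> 1 / C * vnorm (linf N) (basis_vec i :: nat \<Rightarrow> 'k)"
      using linf_coord_le[of i N "basis_vec i :: nat \<Rightarrow> 'k"] i C by (intro mult_left_mono) (auto simp: basis_vec_def)
    also have "\<dots> \<le> vnorm (W p) (y i)"
      using Sb e[OF i] unfolding bounded_below_by_def y_def x_def comp_def by blast
    finally show ?thesis by simp
  qed

  \<comment> \<open>the indices in \<open>V\<close>, all but at most \<open>D1\<close>, have small heads\<close>
  define h where "h i = (\<Sum>j<m. \<Sum>t\<le>j. norm (x i j t) + norm (y i j t))" for i
  have coord: "linear_functional (\<lambda>w. w j t)" for j t by (simp add: linear_functional_def)
  have coord_le: "norm (w j t) \<le> 1 * vnorm (W p) w" if "w \<in> vcarrier (W p)" for j t and w :: "nat \<Rightarrow> nat \<Rightarrow> 'k"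
    using coord_le_W_norm[OF p that] by simp
  have "(\<Sum>i<N. h i) = (\<Sum>j<m. \<Sum>t\<le>j. (\<Sum>i<N. norm (x i j t)) + (\<Sum>i<N. norm (y i j t)))"
    unfolding h_def sum.distrib[symmetric]
    by (subst sum.swap[where A = "{..<N}"], rule sum.cong[OF refl], rule sum.swap)
  also have "\<dots> \<le> (\<Sum>j<m. \<Sum>t\<le>j. C + M * C)"
  proof (intro sum_mono add_mono)
    fix j t
    show "(\<Sum>i<N. norm (x i j t)) \<le> C"
      using sum_functional_basis_le[OF p N S S_le coord _ coord_le, of j t] by (simp add: x_def)
    show "(\<Sum>i<N. norm (y i j t)) \<le> M * C"
      using sum_functional_basis_le[OF p N U U_le coord _ coord_le, of j t] by (simp add: x_def y_def)
  qed
  finally have few: "card {i \<in> {..<N}. h i > \<eta>} \<le> D1"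
    unfolding D1_def using \<eta> by (intro card_large_values) (auto simp: h_def intro!: sum_nonneg)
  define V where "V = {i \<in> {..<N}. h i \<le> \<eta>}"
  have "V = {..<N} - {i \<in> {..<N}. h i > \<eta>}" by (auto simp: V_def)
  then have "card V = N - card {i \<in> {..<N}. h i > \<eta>}"
    using card_Diff_subset[of "{i \<in> {..<N}. h i > \<eta>}" "{..<N}"] by auto
  with few have cardV: "n * (2 * D + 1) \<le> card V" unfolding N_def by linarith
  have VN: "i < N" if "i \<in> V" for i using that by (simp add: V_def)

  have "\<forall>\<^sub>F b in sequentially. \<forall>i\<in>{..<N}. vnorm (W p) (restrict_blocks {b..} (x i)) < \<eta> \<and>
            vnorm (W p) (restrict_blocks {b..} (y i)) < \<eta>"
    using W_tail_tendsto_0[OF p x] W_tail_tendsto_0[OF p y] \<eta>(1)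
    by (intro eventually_ball_finite ballI eventually_conj order_tendstoD) auto
  from eventually_conj[OF this eventually_gt_at_top[of m]]
  obtain m' where m': "m < m'" and tails: "\<And>i. i < N \<Longrightarrow> vnorm (W p) (restrict_blocks {m'..} (x i)) < \<eta>"
    "\<And>i. i < N \<Longrightarrow> vnorm (W p) (restrict_blocks {m'..} (y i)) < \<eta>"
    by (auto dest: eventually_happens)
  define B where "B = {m..<m'}"
  have off: "vnorm (W p) (restrict_blocks (- B) w) \<le> 2 * \<eta>"
    if w: "w \<in> vcarrier (W p)" and hw: "(\<Sum>j<m. \<Sum>t\<le>j. norm (w j t)) \<le> \<eta>"
      and tw: "vnorm (W p) (restrict_blocks {m'..} w) < \<eta>" for w :: "nat \<Rightarrow> nat \<Rightarrow> 'k"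
  proof -
    have "restrict_blocks (- B) w = restrict_blocks {..<m} w + restrict_blocks {m'..} w"
      using m' by (auto simp: restrict_blocks_def B_def fun_eq_iff)
    then have "vnorm (W p) (restrict_blocks (- B) w) \<le>
        vnorm (W p) (restrict_blocks {..<m} w) + vnorm (W p) (restrict_blocks {m'..} w)"
      using W.vnorm_triangle[OF rW(1)[OF w] rW(1)[OF w]] by simp
    then show ?thesis using W_norm_head_le[OF p w, of m] hw tw by linarith
  qed
  have offx: "vnorm (W p) (restrict_blocks (- B) (x i)) \<le> 2 * \<eta>" 
    and offy: "vnorm (W p) (restrict_blocks (- B) (y i)) \<le> 2 * \<eta>" if i: "i \<in> V" for i
  proof -
    have "(\<Sum>j<m. \<Sum>t\<le>j. norm (x i j t)) \<le> h i" "(\<Sum>j<m. \<Sum>t\<le>j. norm (y i j t)) \<le> h i"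
      unfolding h_def by (auto intro!: sum_mono)
    moreover have "h i \<le> \<eta>" using i by (simp add: V_def)
    ultimately show "vnorm (W p) (restrict_blocks (- B) (x i)) \<le> 2 * \<eta>"
      "vnorm (W p) (restrict_blocks (- B) (y i)) \<le> 2 * \<eta>"
      using off[OF x[OF VN[OF i]]] off[OF y[OF VN[OF i]]] tails[OF VN[OF i]] by auto
  qed
  have "\<forall>i\<in>V. \<exists>f. linear_functional f \<and> f (y i) = 1 \<and>
      (\<forall>w. norm (f w) \<le> 2 * C * vnorm (W p) (restrict_blocks B w))"
  proof
    fix i assume i: "i \<in> V"
    let ?\<nu> = "vnorm (W p) (restrict_blocks B (y i))"
    have "vnorm (W p) (y i) \<le> ?\<nu> + vnorm (W p) (restrict_blocks (- B) (y i))"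
      using W.vnorm_triangle[OF rW(1)[OF y[OF VN[OF i]]] rW(1)[OF y[OF VN[OF i]]], of B "- B"]
      by (simp add: restrict_blocks_split)
    then have "1 / C \<le> ?\<nu> + 2 * (1 / (4 * C))" using y_norm[OF VN[OF i]] offy[OF i] \<eta>(2) by linarith
    then have \<nu>: "1 / (2 * C) \<le> ?\<nu>" using C by (simp add: field_simps)
    then have \<nu>0: "?\<nu> > 0" using C by (smt (verit) divide_pos_pos)
    obtain f where f: "linear_functional f" "f (y i) = 1"
      "\<And>w. norm (f w) \<le> vnorm (W p) (restrict_blocks B w) / ?\<nu>"
      using norming_functional[OF p _ \<nu>0] by (auto simp: B_def)
    have "norm (f w) \<le> 2 * C * vnorm (W p) (restrict_blocks B w)" for w
    proof -
      have "1 / ?\<nu> \<le> 2 * C" using \<nu> \<nu>0 C by (simp add: field_simps)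
      then show ?thesis
        using f(3)[of w] mult_right_mono[of "1 / ?\<nu>" "2 * C" "vnorm (W p) (restrict_blocks B w)"] by simp
    qed
    with f show "\<exists>f. linear_functional f \<and> f (y i) = 1 \<and>
      (\<forall>w. norm (f w) \<le> 2 * C * vnorm (W p) (restrict_blocks B w))" by blast
  qed
  then obtain f where f: "\<And>i. i \<in> V \<Longrightarrow> linear_functional (f i)" "\<And>i. i \<in> V \<Longrightarrow> f i (y i) = 1"
    "\<And>i w. i \<in> V \<Longrightarrow> norm (f i w) \<le> 2 * C * vnorm (W p) (restrict_blocks B w)"
    by metis
  \<comment> \<open>the functional \<open>f i \<circ> T \<circ> S\<close> on \<open>\<ell>\<^sub>\<infinity>\<^sup>N\<close> is bounded by \<open>2 * C * (M * C)\<close>\<close>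
  have out: "card {k \<in> V. norm (f i (y k)) > \<eta>} \<le> D" if i: "i \<in> V" for i
  proof -
    have "norm (f i w) \<le> 2 * C * vnorm (W p) w" if "w \<in> vcarrier (W p)" for w
      using f(3)[OF i, of w] mult_left_mono[OF rW(2)[OF that, of B], of "2 * C"] C by linarith
    then have "(\<Sum>k<N. norm (f i (y k))) \<le> 2 * C * (M * C)"
      using sum_functional_basis_le[OF p N U U_le f(1)[OF i], of "2 * C"] C by (simp add: y_def x_def)
    then have "card {k \<in> {..<N}. norm (f i (y k)) > \<eta>} \<le> D"
      unfolding D_def using \<eta> by (intro card_large_values) auto
    moreover have "card {k \<in> V. norm (f i (y k)) > \<eta>} \<le> card {k \<in> {..<N}. norm (f i (y k)) > \<eta>}"
      by (intro card_mono) (auto simp: V_def)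
    ultimately show ?thesis by linarith
  qed
  obtain A where A: "A \<subseteq> V" "card A = n" "\<forall>i\<in>A. \<forall>k\<in>A. i \<noteq> k \<longrightarrow> \<not> norm (f i (y k)) > \<eta>"
    using digraph_independent_set[of V "\<lambda>i k. norm (f i (y k)) > \<eta>" D n, OF _ out cardV]
    by (auto simp: V_def)
  have finA: "finite A" using A(1) by (rule finite_subset) (simp add: V_def)
  obtain a where a: "bij_betw a {0..<n} A" using ex_bij_betw_nat_finite[OF finA] A(2) by auto
  have aA: "a i \<in> A" if "i < n" for i using a that by (auto simp: bij_betw_def)
  have aV: "a i \<in> V" if "i < n" for i using aA[OF that] A(1) by auto
  have a_inj: "a i = a k \<longleftrightarrow> i = k" if "i < n" "k < n" for i k
    using a that by (auto simp: bij_betw_def inj_on_def)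
  define X where "X i = restrict_blocks B (x (a i))" for i
  define F where "F i = f (a i)" for i
  have xa: "x (a i) \<in> vcarrier (W p)" if "i < n" for i using x[OF VN[OF aV[OF that]]] .
  have ya: "y (a i) \<in> vcarrier (W p)" if "i < n" for i using y[OF VN[OF aV[OF that]]] .
  have Xc: "X i \<in> vcarrier (W p)" if "i < n" for i unfolding X_def by (rule rW(1)[OF xa[OF that]])
  \<comment> \<open>the effect on \<open>y (a i)\<close> of truncating \<open>x (a i)\<close> to \<open>B\<close>\<close>
  define d where "d i = T (restrict_blocks (- B) (x (a i)))" for i
  have dc: "d i \<in> vcarrier (W p)" if "i < n" for i
    unfolding d_def by (rule bounded_operatorD(1)[OF T rW(1)[OF xa[OF that]]])
  have d_le: "vnorm (W p) (d i) \<le> 2 * M * \<eta>" if "i < n" for i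
  proof -
    have "vnorm (W p) (d i) \<le> M * vnorm (W p) (restrict_blocks (- B) (x (a i)))"
      unfolding d_def by (rule M(2)[OF rW(1)[OF xa[OF that]]])
    also have "\<dots> \<le> M * (2 * \<eta>)" using offx[OF aV[OF that]] M(1) by (intro mult_left_mono) auto
    finally show ?thesis by (simp add: mult.left_commute)
  qed
  have TX: "T (X i) = y (a i) - d i" if "i < n" for i
  proof -
    have "X i = x (a i) - restrict_blocks (- B) (x (a i))"
      using restrict_blocks_split[of B "x (a i)"] by (simp add: X_def eq_diff_eq)
    then show ?thesis
      using bounded_operator_diff[OF T BW xa[OF that] rW(1)[OF xa[OF that]]] by (simp add: y_def d_def)
  qed
  have "almost_dual_block p T C \<delta> n B X F"
    unfolding almost_dual_block_def
  proof (intro conjI allI impI)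
    fix i assume i: "i < n"
    show "X i \<in> vcarrier (W p)" by (rule Xc[OF i])
    show "restrict_blocks B (X i) = X i" by (auto simp: X_def restrict_blocks_def fun_eq_iff)
  next
    fix v :: "nat \<Rightarrow> 'k"
    let ?v = "\<Sum>i<n. vscale (linf N) (v i) (basis_vec (a i))"
    have ea: "basis_vec (a i) \<in> vcarrier (linf N)" if "i \<in> {..<n}" for i
      using that by (intro e VN aV) auto
    have vc: "?v \<in> vcarrier (linf N)" and Sv: "S ?v = (\<Sum>i<n. vscale (W p) (v i) (x (a i)))"
      unfolding x_def using bounded_operator_sum[OF S BN _ ea, where I = "{..<n}" and c = v] by auto
    have "vnorm (linf N) ?v \<le> vnorm (linf n) v"
      unfolding linf_norm_le_iff[OF N]
    proof (intro allI impI)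
      fix t
      have eq: "?v t = (\<Sum>i<n. if a i = t then v i else 0)"
        by (auto simp: sum_fun_apply basis_vec_def intro!: sum.cong)
      show "norm (?v t) \<le> vnorm (linf n) v"
      proof (cases "\<exists>k<n. a k = t")
        case True
        then obtain k where k: "k < n" "a k = t" by blast
        have "?v t = (\<Sum>i<n. if i = k then v i else 0)"
          unfolding eq using k a_inj[OF _ k(1)] by (intro sum.cong) auto
        then have "?v t = v k" using k by simp
        then show ?thesis using linf_coord_le[OF k(1)] by metis
      next
        case False
        then have "?v t = 0" unfolding eq by (intro sum.neutral) auto
        then show ?thesis using linf_norm_nonneg[OF n, of v] by (metis norm_zero)
      qed
    qed
    then have "C * vnorm (linf N) ?v \<le> C * vnorm (linf n) v" using C by (intro mult_left_mono) auto
    moreover have "(\<Sum>i<n. vscale (W p) (v i) (X i)) = restrict_blocks B (S ?v)"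
      unfolding Sv restrict_blocks_sum X_def ..
    then have "vnorm (W p) (\<Sum>i<n. vscale (W p) (v i) (X i)) \<le> vnorm (W p) (S ?v)"
      using rW(2)[OF bounded_operatorD(1)[OF S vc]] by metis
    ultimately show "vnorm (W p) (\<Sum>i<n. vscale (W p) (v i) (X i)) \<le> C * vnorm (linf n) v"
      using S_le[OF vc] by linarith
  next
    fix i assume i: "i < n"
    show "linear_functional (F i)" unfolding F_def by (rule f(1)[OF aV[OF i]])
    show "norm (F i w) \<le> 2 * C * vnorm (W p) (restrict_blocks B w)" for w
      unfolding F_def by (rule f(3)[OF aV[OF i]])
  next
    fix i k assume i: "i < n" and k: "k < n"
    have "norm (F i (d k)) \<le> 2 * C * vnorm (W p) (d k)"
      using f(3)[OF aV[OF i], of "d k"] mult_left_mono[OF rW(2)[OF dc[OF k], of B], of "2 * C"] C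
      unfolding F_def by linarith
    also have "\<dots> \<le> 2 * C * (2 * M * \<eta>)" using d_le[OF k] C by (intro mult_left_mono) auto
    finally have "norm (F i (d k)) \<le> 4 * C * M * \<eta>" by (simp add: algebra_simps)
    moreover define e :: 'k where "e = (if i = k then 1 else 0)"
    moreover have "norm (F i (y (a k)) - e) \<le> \<eta>"
      using A(3) aA[OF i] aA[OF k] a_inj[OF i k] f(2)[OF aV[OF i]] \<eta>(1) by (auto simp: F_def e_def not_less)
    moreover have "F i (T (X k)) - e = (F i (y (a k)) - e) - F i (d k)"
      unfolding TX[OF k] F_def linear_functional_diff[OF f(1)[OF aV[OF i]]] by simp
    then have "norm (F i (T (X k)) - e) \<le> norm (F i (y (a k)) - e) + norm (F i (d k))"
      by (simp only: norm_triangle_ineq4)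
    ultimately have "norm (F i (T (X k)) - (if i = k then 1 else 0)) \<le> \<eta> + 4 * C * M * \<eta>"
      unfolding e_def[symmetric] by linarith
    also have "\<dots> \<le> K * \<eta>" using \<eta>(1) by (simp add: K_def algebra_simps)
    finally show "norm (F i (T (X k)) - (if i = k then 1 else 0)) \<le> \<delta>" using \<eta>(3) by linarith
  next
    fix i assume i: "i < n"
    have "vnorm (W p) (restrict_blocks (- B) (T (X i))) \<le>
        vnorm (W p) (restrict_blocks (- B) (y (a i))) + vnorm (W p) (restrict_blocks (- B) (d i))"
      unfolding TX[OF i] restrict_blocks_diff by (rule W.vnorm_diff_le[OF rW(1)[OF ya[OF i]] rW(1)[OF dc[OF i]]])
    also have "\<dots> \<le> 2 * \<eta> + 2 * M * \<eta>"
      using offy[OF aV[OF i]] rW(2)[OF dc[OF i], of "- B"] d_le[OF i] by linarith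
    also have "\<dots> \<le> K * \<eta>"
    proof -
      have "M * 1 \<le> M * C" using M(1) C by (intro mult_left_mono) auto
      then have "2 + 2 * M \<le> K" using M(1) by (simp add: K_def mult.commute)
      then have "(2 + 2 * M) * \<eta> \<le> K * \<eta>" using \<eta>(1) by (intro mult_right_mono) auto
      then show ?thesis by (simp add: algebra_simps)
    qed
    finally show "vnorm (W p) (restrict_blocks (- B) (T (X i))) \<le> \<delta>" using \<eta>(3) by linarith
  qed
  then show ?thesis using m' unfolding B_def by blast
qed

section \<open>Gluing the blocks\<close>

lemma sum_consecutive_blocks:
  fixes g :: "nat \<Rightarrow> 'b::comm_monoid_add"
  assumes "strict_mono (m :: nat \<Rightarrow> nat)" "m 0 = 0"
  shows "(\<Sum>j<m L. g j) = (\<Sum>l<L. \<Sum>j\<in>{m l..<m (Suc l)}. g j)"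
proof (induction L)
  case (Suc L)
  have "m L \<le> m (Suc L)" using assms(1) by (simp add: strict_mono_less_eq)
  then have "(\<Sum>j<m (Suc L). g j) = (\<Sum>j<m L. g j) + (\<Sum>j\<in>{m L..<m (Suc L)}. g j)"
    by (simp add: lessThan_atLeast0 sum.atLeastLessThan_concat)
  then show ?case using Suc by simp
qed (use assms in simp)

text \<open>
  The \<open>l\<close>-th block has \<open>l + 1\<close> unit vectors, so the errors on the unit vectors add up to at most
  \<open>\<Sum>\<^sub>l 1 / 2^(l + 2) = 1/2\<close> on vectors with finitely many nonzero blocks, coordinates being bounded
  by the norm. Such vectors are dense since \<open>p\<close> is finite, and \<open>A\<close> is bounded.
\<close>

lemma bounded_near_identity_on_basis:
  fixes A :: "(nat \<Rightarrow> nat \<Rightarrow> 'k) \<Rightarrow> nat \<Rightarrow> nat \<Rightarrow> 'k::{real_normed_field,banach}"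
  assumes p: "p > 1" and A: "bounded_operator (W p) (W p) A"
    and near: "\<And>l i. i \<le> l \<Longrightarrow>
      vnorm (W p) (A (single_block l (basis_vec i)) - single_block l (basis_vec i))
        \<le> 1 / (real (Suc l) * 2 ^ (l + 2))"
    and x: "x \<in> vcarrier (W p)"
  shows "vnorm (W p) (A x - x) \<le> 1 / 2 * vnorm (W p) x"
proof -
  have BW: "banach_space (W p :: ('k, nat \<Rightarrow> nat \<Rightarrow> 'k) nspace)" using p by (intro banach_space_W) simp
  interpret W: banach_space "W p :: ('k, nat \<Rightarrow> nat \<Rightarrow> 'k) nspace" by (rule BW)
  define E :: "nat \<times> nat \<Rightarrow> nat \<Rightarrow> nat \<Rightarrow> 'k" where "E q = single_block (fst q) (basis_vec (snd q))" for q
  obtain M where M: "M \<ge> 1" "\<And>x. x \<in> vcarrier (W p) \<Longrightarrow> vnorm (W p) (A x) \<le> M * vnorm (W p) x"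
    using bounded_operator_bound[OF A BW] by blast
  have Ec: "E q \<in> vcarrier (W p)" if "snd q \<le> fst q" for q
    unfolding E_def using that by (intro single_block_in_W) (simp add: basis_vec_def)
  define rest where "rest L = restrict_blocks {L..} x" for L
  have rest: "rest L \<in> vcarrier (W p)" for L unfolding rest_def by (rule restrict_blocks_W(1)[OF p x])
  have finite_part: "vnorm (W p) (A (x - rest L) - (x - rest L)) \<le> 1 / 2 * vnorm (W p) x" for L
  proof -
    define I where "I = Sigma {..<L} (\<lambda>l. {..l})"
    define c where "c q = x (fst q) (snd q)" for q
    have I: "finite I" "\<And>q. q \<in> I \<Longrightarrow> snd q \<le> fst q" by (auto simp: I_def)
    have xL: "x - rest L = (\<Sum>q\<in>I. vscale (W p) (c q) (E q))"
    proof (intro ext)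
      fix j t
      have "(\<Sum>q\<in>I. vscale (W p) (c q) (E q)) j t = (\<Sum>q\<in>I. if q = (j, t) then x j t else 0)"
        unfolding sum_fun_apply by (intro sum.cong) (auto simp: c_def E_def single_block_def basis_vec_def)
      also have "\<dots> = (if (j, t) \<in> I then x j t else 0)" using I by simp
      also have "\<dots> = (x - rest L) j t"
        using x by (auto simp: I_def rest_def restrict_blocks_def W_carrier_iff)
      finally show "(x - rest L) j t = (\<Sum>q\<in>I. vscale (W p) (c q) (E q)) j t" ..
    qed
    have d: "A (E q) - E q \<in> vcarrier (W p)" if "q \<in> I" for q
      using Ec[OF I(2)[OF that]] bounded_operatorD(1)[OF A] W.carrier_diff by blast
    have "A (x - rest L) = (\<Sum>q\<in>I. vscale (W p) (c q) (A (E q)))"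
      unfolding xL by (rule bounded_operator_sum(2)[OF A BW I(1)]) (rule Ec[OF I(2)])
    then have "A (x - rest L) - (x - rest L) = (\<Sum>q\<in>I. vscale (W p) (c q) (A (E q) - E q))"
      unfolding xL by (simp only: sum_subtractf[symmetric] W.scale_right_diff_distrib)
    then have "vnorm (W p) (A (x - rest L) - (x - rest L)) \<le> (\<Sum>q\<in>I. vnorm (W p) (vscale (W p) (c q) (A (E q) - E q)))"
      using W.vnorm_sum_le(2)[of I "\<lambda>q. vscale (W p) (c q) (A (E q) - E q)"]
        W.subspace_scale[OF W.subspace_carrier d] by metis
    also have "\<dots> \<le> (\<Sum>q\<in>I. vnorm (W p) x * (1 / (real (Suc (fst q)) * 2 ^ (fst q + 2))))"
    proof (rule sum_mono)
      fix q assume q: "q \<in> I"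
      have "vnorm (W p) (vscale (W p) (c q) (A (E q) - E q)) = norm (c q) * vnorm (W p) (A (E q) - E q)"
        by (rule W.vnorm_scale[OF d[OF q]])
      also have "\<dots> \<le> vnorm (W p) x * (1 / (real (Suc (fst q)) * 2 ^ (fst q + 2)))"
        using near[OF I(2)[OF q]] coord_le_W_norm[OF p x] unfolding E_def c_def
        by (intro mult_mono) auto
      finally show "vnorm (W p) (vscale (W p) (c q) (A (E q) - E q)) \<le> vnorm (W p) x * (1 / (real (Suc (fst q)) * 2 ^ (fst q + 2)))" .
    qed
    also have "\<dots> = (\<Sum>l<L. \<Sum>i\<le>l. vnorm (W p) x * (1 / (real (Suc l) * 2 ^ (l + 2))))"
      unfolding I_def by (subst sum.Sigma) (simp_all only: case_prod_unfold finite_lessThan finite_atMost simp_thms ball_triv)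
    also have "\<dots> = vnorm (W p) x * (\<Sum>l<L. \<Sum>i\<le>l. 1 / (real (Suc l) * 2 ^ (l + 2)))"
      by (simp only: sum_distrib_left)
    also have "(\<Sum>l<L. \<Sum>i\<le>l. 1 / (real (Suc l) * 2 ^ (l + 2))) = (\<Sum>l<L. 1 / 2 ^ (l + 2))"
      by (intro sum.cong refl) (simp del: of_nat_Suc)
    also have "\<dots> = 1 / 2 - 1 / 2 ^ Suc L"
      by (induction L) (simp_all add: field_simps)
    also have "vnorm (W p) x * (1 / 2 - 1 / 2 ^ Suc L) \<le> vnorm (W p) x * (1 / 2)"
      by (intro mult_left_mono) auto
    finally show ?thesis by (simp only: mult.commute)
  qed
  have "vnorm (W p) (A x - x) \<le> (M + 1) * vnorm (W p) (rest L) + 1 / 2 * vnorm (W p) x" for L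
  proof -
    have xr: "x - rest L \<in> vcarrier (W p)" by (rule W.carrier_diff[OF x rest])
    have c: "A (x - rest L) - (x - rest L) \<in> vcarrier (W p)" "A (rest L) - rest L \<in> vcarrier (W p)"
      "A (rest L) \<in> vcarrier (W p)"
      using xr rest bounded_operatorD(1)[OF A] W.carrier_diff by blast+
    have eq: "A x - x = (A (x - rest L) - (x - rest L)) + (A (rest L) - rest L)"
      unfolding bounded_operator_diff[OF A BW x rest] by (simp add: algebra_simps)
    have "vnorm (W p) (A x - x) \<le> vnorm (W p) (A (x - rest L) - (x - rest L)) + vnorm (W p) (A (rest L) - rest L)"
      unfolding eq by (rule W.vnorm_triangle[OF c(1,2)])
    moreover have "vnorm (W p) (A (rest L) - rest L) \<le> M * vnorm (W p) (rest L) + vnorm (W p) (rest L)"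
      using W.vnorm_diff_le[OF c(3) rest[of L]] M(2)[OF rest, of L] by linarith
    ultimately show ?thesis using finite_part[of L] unfolding distrib_right mult_1_left by linarith
  qed
  moreover have "(\<lambda>L. (M + 1) * vnorm (W p) (rest L) + 1 / 2 * vnorm (W p) x) \<longlonglongrightarrow> (M + 1) * 0 + 1 / 2 * vnorm (W p) x"
    unfolding rest_def by (intro tendsto_add tendsto_mult tendsto_const W_tail_tendsto_0[OF p x])
  ultimately show ?thesis
    by (intro LIMSEQ_le_const[where X = "\<lambda>L. (M + 1) * vnorm (W p) (rest L) + 1 / 2 * vnorm (W p) x"]) auto
qed

text \<open>
  With consecutive windows \<open>B l\<close> carrying almost dual systems of \<open>l + 1\<close> vectors, \<open>R\<close> spreads the
  \<open>l\<close>-th block over \<open>B l\<close> and \<open>S\<close> collects \<open>B l\<close> into the \<open>l\<close>-th block. Both are bounded because the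
  \<open>p\<close>-th powers of the norms of the restrictions to disjoint windows add up.
\<close>

lemma identity_factors_if_fixes_linf:
  fixes T :: "(nat \<Rightarrow> nat \<Rightarrow> 'k) \<Rightarrow> nat \<Rightarrow> nat \<Rightarrow> 'k::{real_normed_field,banach}"
  assumes p: "p > 1" and T: "bounded_operator (W p) (W p) T" and C: "C \<ge> 1"
    and fix_copies: "\<And>N. N \<ge> 1 \<Longrightarrow> fixes_copy C (W p) (W p) T (linf N :: ('k, nat \<Rightarrow> 'k) nspace)"
  shows "identity_factors_through (W p) T"
proof -
  have BW: "banach_space (W p :: ('k, nat \<Rightarrow> nat \<Rightarrow> 'k) nspace)" using p by (intro banach_space_W) simp
  interpret W: banach_space "W p :: ('k, nat \<Rightarrow> nat \<Rightarrow> 'k) nspace" by (rule BW)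
  note rW = restrict_blocks_W[OF p]
  define \<delta> where "\<delta> l = 1 / (real (Suc l) * 2 ^ (l + 2)) / (1 + 2 * C)" for l
  have \<delta>: "\<delta> l > 0" "(1 + 2 * C) * \<delta> l = 1 / (real (Suc l) * 2 ^ (l + 2))" for l
    using C by (simp_all add: \<delta>_def)
  have "\<exists>m' X F. m < m' \<and> almost_dual_block p T C (\<delta> l) (Suc l) {m..<m'} X F" for l m
    using almost_dual_block_exists[OF p T C \<delta>(1) fix_copies] by simp
  then have "\<forall>q. \<exists>r. snd q < fst r \<and> almost_dual_block p T C (\<delta> (fst q)) (Suc (fst q))
      {snd q..<fst r} (fst (snd r)) (snd (snd r))"
    by (simp only: split_paired_all split_paired_Ex fst_conv snd_conv simp_thms)
  from choice[OF this] obtain g where g: "\<And>q. snd q < fst (g q)"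
    "\<And>q. almost_dual_block p T C (\<delta> (fst q)) (Suc (fst q))
      {snd q..<fst (g q)} (fst (snd (g q))) (snd (snd (g q)))"
    by blast
  define nxt where "nxt l m = fst (g (l, m))" for l m
  define X0 where "X0 l m = fst (snd (g (l, m)))" for l m
  define F0 where "F0 l m = snd (snd (g (l, m)))" for l m
  have nxt: "m < nxt l m"
    and blk0: "almost_dual_block p T C (\<delta> l) (Suc l) {m..<nxt l m} (X0 l m) (F0 l m)" for l m
    using g[of "(l, m)"] by (simp_all add: nxt_def X0_def F0_def)
  define m where "m = rec_nat 0 nxt"
  have m0: "m 0 = 0" and mSuc: "m (Suc l) = nxt l (m l)" for l by (simp_all add: m_def)
  have mono: "strict_mono m" by (rule strict_monoI_Suc) (simp add: mSuc nxt)
  define B where "B l = {m l..<m (Suc l)}" for l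
  define X where "X l = X0 l (m l)" for l
  define F where "F l = F0 l (m l)" for l
  have "almost_dual_block p T C (\<delta> l) (Suc l) (B l) (X l) (F l)" for l
    using blk0[of l "m l"] by (simp add: B_def X_def F_def mSuc)
  note blk = this[unfolded almost_dual_block_def less_Suc_eq_le, rule_format]
  have Xc: "X l i \<in> vcarrier (W p)" and XB: "restrict_blocks (B l) (X l i) = X l i" if "i \<le> l" for l i
    using blk[of l] that by auto
  have Xn: "vnorm (W p) (\<Sum>i<Suc l. vscale (W p) (v i) (X l i)) \<le> C * block_norm l v" for l v
    using blk[of l] by (simp add: less_Suc_eq_le)
  have Flin: "linear_functional (F l i)" and Fn: "norm (F l i w) \<le> 2 * C * vnorm (W p) (restrict_blocks (B l) w)"
    if "i \<le> l" for l i w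
    using blk[of l] that by auto
  have FTX: "norm (F l i (T (X l k)) - (if i = k then 1 else 0)) \<le> \<delta> l" if "i \<le> l" "k \<le> l" for l i k
    using blk[of l] that by blast
  have offTX: "vnorm (W p) (restrict_blocks (- B l) (T (X l i))) \<le> \<delta> l" if "i \<le> l" for l i
    using blk[of l] that by auto
  have disj: "j \<notin> B k" if "j \<in> B l" "k \<noteq> l" for j k l
  proof
    assume k: "j \<in> B k"
    from \<open>k \<noteq> l\<close> consider "Suc k \<le> l" | "Suc l \<le> k" by linarith
    then show False
      using k that(1) strict_mono_mono[OF mono, THEN monoD, of "Suc k" l]
        strict_mono_mono[OF mono, THEN monoD, of "Suc l" k] by cases (auto simp: B_def)
  qed
  have le_B: "l \<le> j" if "j \<in> B l" for j l
    using that strict_mono_imp_increasing[OF mono, of l] by (simp add: B_def)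
  have X_zero: "X l i j t = 0" if "i \<le> l" "j \<notin> B l" for l i j t
  proof -
    have "restrict_blocks (B l) (X l i) j t = 0" using that(2) by (simp add: restrict_blocks_def)
    then show ?thesis using XB[OF that(1)] by simp
  qed
  have X_zero': "X l i j t = 0" if "i \<le> l" "j < t" for l i j t
    using Xc[OF that(1)] that(2) unfolding W_carrier_iff by blast
  have blocks: "(\<Sum>j<m L. g j) = (\<Sum>l<L. \<Sum>j\<in>B l. g j)" for L and g :: "nat \<Rightarrow> real"
    unfolding B_def by (rule sum_consecutive_blocks[OF mono m0])

  \<comment> \<open>a finite sum, hence visibly linear: the window \<open>B l\<close> contains no \<open>j < l\<close>\<close>
  define R where "R x = (\<lambda>j t. \<Sum>l\<le>j. \<Sum>i\<le>l. x l i * X l i j t)" for x :: "nat \<Rightarrow> nat \<Rightarrow> 'k"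
  have R_block: "R x j = (\<Sum>i<Suc l. vscale (W p) (x l i) (X l i)) j" if j: "j \<in> B l" for x j l
  proof
    fix t
    define c where "c = (\<Sum>i\<le>l. x l i * X l i j t)"
    have inner: "(\<Sum>i\<le>l'. x l' i * X l' i j t) = (if l' = l then c else 0)" for l'
      using disj[OF j, of l'] X_zero[of _ l' j t] by (cases "l' = l") (simp_all add: c_def)
    have "R x j t = c"
      unfolding R_def inner using le_B[OF j] by simp
    then show "R x j t = (\<Sum>i<Suc l. vscale (W p) (x l i) (X l i)) j t"
      by (simp add: sum_fun_apply lessThan_Suc_atMost c_def)
  qed
  have R_bound: "R x \<in> vcarrier (W p)" "vnorm (W p) (R x) \<le> C * vnorm (W p) x" if x: "x \<in> vcarrier (W p)" for x
  proof -
    have z: "R x j i = 0" if "j < i" for j i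
      unfolding R_def by (simp add: X_zero'[OF _ that])
    have "(\<Sum>j<m L. block_norm j (R x j) powr p) \<le> (C * vnorm (W p) x) powr p" for L
    proof -
      have "(\<Sum>j<m L. block_norm j (R x j) powr p) \<le> (\<Sum>l<L. C powr p * block_norm l (x l) powr p)"
        unfolding blocks
      proof (rule sum_mono)
        fix l
        let ?u = "\<Sum>i<Suc l. vscale (W p) (x l i) (X l i)"
        have u: "?u \<in> vcarrier (W p)"
          by (rule W.vnorm_sum_le(1), rule W.subspace_scale[OF W.subspace_carrier], rule Xc) simp
        have "(\<Sum>j\<in>B l. block_norm j (R x j) powr p) = (\<Sum>j\<in>B l. block_norm j (?u j) powr p)"
          by (intro sum.cong refl) (simp only: R_block[of _ l])
        also have "\<dots> \<le> vnorm (W p) ?u powr p" by (rule W_sum_le_norm_powr[OF p u]) (simp add: B_def)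
        also have "\<dots> \<le> (C * block_norm l (x l)) powr p" using p Xn by (intro powr_mono2) auto
        also have "\<dots> = C powr p * block_norm l (x l) powr p" using C by (simp add: powr_mult)
        finally show "(\<Sum>j\<in>B l. block_norm j (R x j) powr p) \<le> C powr p * block_norm l (x l) powr p" .
      qed
      also have "\<dots> \<le> C powr p * vnorm (W p) x powr p"
        unfolding sum_distrib_left[symmetric] by (intro mult_left_mono W_sum_le_norm_powr[OF p x]) auto
      also have "\<dots> = (C * vnorm (W p) x) powr p" using C by (simp add: powr_mult)
      finally show ?thesis .
    qed
    note bound = this
    have "0 \<le> C * vnorm (W p) x" using C by simp
    from W_boundI[OF p this z mono bound]
    show "R x \<in> vcarrier (W p)" "vnorm (W p) (R x) \<le> C * vnorm (W p) x" by simp_all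
  qed
  have R: "bounded_operator (W p) (W p) R"
    unfolding bounded_operator_def
  proof (intro conjI ballI allI)
    show "R (x + y) = R x + R y" for x y
      by (simp add: R_def fun_eq_iff distrib_right sum.distrib)
    show "R (vscale (W p) c x) = vscale (W p) c (R x)" for c x
      by (simp add: R_def fun_eq_iff sum_distrib_left mult.assoc)
  qed (use R_bound in blast)+

  define S where "S y = (\<lambda>l i. if i \<le> l then F l i y else 0)" for y
  have S_bound: "S y \<in> vcarrier (W p)" "vnorm (W p) (S y) \<le> 2 * C * vnorm (W p) y" if y: "y \<in> vcarrier (W p)" for y
  proof -
    have z: "S y l i = 0" if "l < i" for l i using that by (simp add: S_def)
    have "(\<Sum>l<id L. block_norm l (S y l) powr p) \<le> (2 * C * vnorm (W p) y) powr p" for L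
    proof -
      have "(\<Sum>l<L. block_norm l (S y l) powr p) \<le> (\<Sum>l<L. (2 * C) powr p * (\<Sum>j\<in>B l. block_norm j (y j) powr p))"
      proof (rule sum_mono)
        fix l
        have "block_norm l (S y l) \<le> 2 * C * vnorm (W p) (restrict_blocks (B l) y)"
          using Fn by (auto simp: linf_norm_le_iff S_def)
        then have "block_norm l (S y l) powr p \<le> (2 * C * vnorm (W p) (restrict_blocks (B l) y)) powr p"
          using p by (intro powr_mono2) auto
        also have "\<dots> = (2 * C) powr p * (\<Sum>j\<in>B l. block_norm j (y j) powr p)"
          using C p by (simp add: powr_mult W_norm_restrict_finite B_def powr_powr sum_nonneg)
        finally show "block_norm l (S y l) powr p \<le> (2 * C) powr p * (\<Sum>j\<in>B l. block_norm j (y j) powr p)" .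
      qed
      also have "\<dots> = (2 * C) powr p * (\<Sum>j<m L. block_norm j (y j) powr p)"
        unfolding blocks sum_distrib_left ..
      also have "\<dots> \<le> (2 * C) powr p * vnorm (W p) y powr p"
        by (intro mult_left_mono W_sum_le_norm_powr[OF p y]) auto
      also have "\<dots> = (2 * C * vnorm (W p) y) powr p" using C by (simp add: powr_mult)
      finally show ?thesis by simp
    qed
    note bound = this
    have "0 \<le> 2 * C * vnorm (W p) y" using C by simp
    from W_boundI[OF p this z strict_mono_id bound]
    show "S y \<in> vcarrier (W p)" "vnorm (W p) (S y) \<le> 2 * C * vnorm (W p) y" by simp_all
  qed
  have S: "bounded_operator (W p) (W p) S"
    unfolding bounded_operator_def
  proof (intro conjI ballI allI)
    show "S (x + y) = S x + S y" for x y
      using Flin by (auto simp: S_def fun_eq_iff linear_functional_def)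
    show "S (vscale (W p) c x) = vscale (W p) c (S x)" for c x
      using Flin by (auto simp: S_def fun_eq_iff linear_functional_def)
  qed (use S_bound in blast)+

  have F_zero: "F l i w = 0" if "i \<le> l" "restrict_blocks (B l) w = 0" for l i w
    using Fn[OF that(1), of w] that(2) W.vnorm_zero by (simp only: mult_zero_right norm_le_zero_iff)
  let ?A = "S \<circ> (T \<circ> R)"
  have A: "bounded_operator (W p) (W p) ?A"
    by (intro bounded_operator_comp[OF _ S BW BW] bounded_operator_comp[OF R T BW BW])
  have near: "vnorm (W p) (?A E - E) \<le> 1 / (real (Suc l) * 2 ^ (l + 2))"
    if i: "i \<le> l" and E: "E = single_block l (basis_vec i)" for l i E
  proof -
    have "R E = X l i"
    proof (intro ext)
      fix j t
      have inner: "(\<Sum>i'\<le>l'. E l' i' * X l' i' j t) = (if l' = l then X l i j t else 0)" for l'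
        using i by (auto simp: E single_block_def basis_vec_def if_distrib[of "\<lambda>c. c * _"] cong: if_cong)
      show "R E j t = X l i j t"
        unfolding R_def inner using X_zero[OF i, of j t] le_B[of j l] by auto
    qed
    define y where "y = T (X l i)"
    have y: "y \<in> vcarrier (W p)" unfolding y_def by (rule bounded_operatorD(1)[OF T Xc[OF i]])
    \<comment> \<open>\<open>z\<close> is the failure of biorthogonality; the part of \<open>y\<close> outside \<open>B l\<close> is treated separately\<close>
    define z where "z = S (restrict_blocks (B l) y) - E"
    have z_off: "z k = 0" if "k \<noteq> l" for k
    proof -
      have "restrict_blocks (B k) (restrict_blocks (B l) y) = 0"
        using disj that by (auto simp: restrict_blocks_def fun_eq_iff)
      then show ?thesis using F_zero that by (auto simp: z_def S_def E single_block_def fun_eq_iff)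
    qed
    have z_l: "norm (z l t) \<le> \<delta> l" if t: "t \<le> l" for t
    proof -
      have "restrict_blocks (B l) (y - restrict_blocks (B l) y) = 0"
        by (auto simp: restrict_blocks_def fun_eq_iff)
      then have "F l t y = F l t (restrict_blocks (B l) y)"
        using F_zero[OF t, of "y - restrict_blocks (B l) y"] linear_functional_diff[OF Flin[OF t]] by simp
      then show ?thesis using FTX[OF t i] t by (simp add: z_def S_def E single_block_def basis_vec_def y_def)
    qed
    have "vnorm (W p) z = block_norm l (z l)"
      using z_off by (intro W_norm_single_block[OF p]) (simp add: zero_fun_def)
    also have "\<dots> \<le> \<delta> l" using z_l by (simp add: linf_norm_le_iff)
    finally have z: "vnorm (W p) z \<le> \<delta> l" .
    have "vnorm (W p) (S (restrict_blocks (- B l) y)) \<le> 2 * C * vnorm (W p) (restrict_blocks (- B l) y)"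
      by (rule S_bound(2)[OF rW(1)[OF y]])
    also have "\<dots> \<le> 2 * C * \<delta> l" using offTX[OF i] C by (intro mult_left_mono) (auto simp: y_def)
    finally have off: "vnorm (W p) (S (restrict_blocks (- B l) y)) \<le> 2 * C * \<delta> l" .
    have "E \<in> vcarrier (W p)"
      unfolding E using i by (intro single_block_in_W) (simp add: basis_vec_def)
    then have zc: "z \<in> vcarrier (W p)"
      unfolding z_def by (intro W.carrier_diff S_bound(1) rW(1) y)
    have "S y = S (restrict_blocks (B l) y) + S (restrict_blocks (- B l) y)"
      using bounded_operatorD(2)[OF S rW(1)[OF y, of "B l"] rW(1)[OF y, of "- B l"]]
      by (simp only: restrict_blocks_split)
    then have "?A E - E = z + S (restrict_blocks (- B l) y)"
      using \<open>R E = X l i\<close> by (simp add: z_def y_def)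
    then have "vnorm (W p) (?A E - E) \<le> vnorm (W p) z + vnorm (W p) (S (restrict_blocks (- B l) y))"
      using W.vnorm_triangle[OF zc S_bound(1)[OF rW(1)[OF y]]] by metis
    also have "\<dots> \<le> (1 + 2 * C) * \<delta> l" using z off by (simp add: distrib_right)
    finally show ?thesis unfolding \<delta>(2) .
  qed
  have "vnorm (W p) (?A x - x) \<le> 1 / 2 * vnorm (W p) x" if "x \<in> vcarrier (W p)" for x
    by (rule bounded_near_identity_on_basis[OF p A near[OF _ refl] that])
  from right_inverse_near_identity[OF BW A _ _ this]
  obtain H where H: "bounded_operator (W p) (W p) H" "\<And>y. y \<in> vcarrier (W p) \<Longrightarrow> ?A (H y) = y" by auto
  show ?thesis
    unfolding identity_factors_through_def
  proof (intro exI conjI ballI)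
    show "bounded_operator (W p) (W p) (R \<circ> H)" by (rule bounded_operator_comp[OF H(1) R BW BW])
    show "bounded_operator (W p) (W p) S" by (rule S)
    show "S (T ((R \<circ> H) x)) = x" if "x \<in> vcarrier (W p)" for x using H(2)[OF that] by simp
  qed
qed

text \<open>
  The copy of \<open>\<ell>\<^sub>\<infinity>\<^sup>N\<close> is the image under \<open>R\<close> of the summand itself; \<open>S\<close> bounds \<open>T \<circ> R\<close> from below.
\<close>

lemma fixes_linf_if_identity_factors:
  fixes T :: "(nat \<Rightarrow> nat \<Rightarrow> 'k) \<Rightarrow> nat \<Rightarrow> nat \<Rightarrow> 'k::{real_normed_field,banach}"
  assumes p: "p > 1" and T: "bounded_operator (W p) (W p) T" and fac: "identity_factors_through (W p) T"
  shows "\<exists>C\<ge>1. \<forall>N\<ge>1. fixes_copy C (W p) (W p) T (linf N :: ('k, nat \<Rightarrow> 'k) nspace)"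
proof -
  have BW: "banach_space (W p :: ('k, nat \<Rightarrow> nat \<Rightarrow> 'k) nspace)" using p by (intro banach_space_W) simp
  obtain R S where R: "bounded_operator (W p) (W p) R" and S: "bounded_operator (W p) (W p) S"
    and STR: "\<And>x. x \<in> vcarrier (W p) \<Longrightarrow> S (T (R x)) = x"
    using fac unfolding identity_factors_through_def by blast
  obtain MR where MR: "MR \<ge> 1" "\<And>x. x \<in> vcarrier (W p) \<Longrightarrow> vnorm (W p) (R x) \<le> MR * vnorm (W p) x"
    using bounded_operator_bound[OF R BW] by blast
  obtain MS where MS: "MS \<ge> 1" "\<And>x. x \<in> vcarrier (W p) \<Longrightarrow> vnorm (W p) (S x) \<le> MS * vnorm (W p) x"
    using bounded_operator_bound[OF S BW] by blast
  define C where "C = max MR MS"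
  have C: "C \<ge> 1" "MR \<le> C" "MS \<le> C" using MR by (auto simp: C_def)
  have "fixes_copy C (W p) (W p) T (linf N :: ('k, nat \<Rightarrow> 'k) nspace)" if N: "N \<ge> 1" for N
  proof -
    note BN = banach_space_linf[OF N, where 'k='k]
    obtain k where k: "N = Suc k" using N by (cases N) auto
    define J :: "(nat \<Rightarrow> 'k) \<Rightarrow> nat \<Rightarrow> nat \<Rightarrow> 'k" where "J = single_block k"
    have Jc: "J v \<in> vcarrier (W p)" if "v \<in> vcarrier (linf N)" for v
      using that unfolding J_def k by (rule single_block_in_W)
    have Jn: "vnorm (W p) (J v) = vnorm (linf N) v" for v
      using W_norm_single_block[OF p, of k "J v"] by (simp add: J_def single_block_def k)
    have J: "bounded_operator (linf N) (W p) J"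
      unfolding bounded_operator_def
    proof (intro conjI ballI allI)
      show "J (x + y) = J x + J y" for x y by (auto simp: J_def single_block_def fun_eq_iff)
      show "J (vscale (linf N) c x) = vscale (W p) c (J x)" for c x by (auto simp: J_def single_block_def fun_eq_iff)
      show "\<exists>M. \<forall>x\<in>vcarrier (linf N). vnorm (W p) (J x) \<le> M * vnorm (linf N) x"
        by (intro exI[of _ 1]) (simp add: Jn)
    qed (rule Jc)
    show ?thesis
      unfolding fixes_copy_def
    proof (intro exI conjI)
      show "bounded_operator (linf N) (W p) (R \<circ> J)" by (rule bounded_operator_comp[OF J R BN BW])
      show "operator_norm (linf N) (W p) (R \<circ> J) \<le> C"
      proof (rule operator_norm_leI[OF BN])
        fix v :: "nat \<Rightarrow> 'k" assume v: "v \<in> vcarrier (linf N)"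
        have "vnorm (W p) (R (J v)) \<le> MR * vnorm (linf N) v" using MR(2)[OF Jc[OF v]] by (simp only: Jn)
        also have "\<dots> \<le> C * vnorm (linf N) v" using C linf_norm_nonneg[OF N] by (intro mult_right_mono) auto
        finally show "vnorm (W p) ((R \<circ> J) v) \<le> C * vnorm (linf N) v" by simp
      qed (use C in simp)
      show "bounded_below_by (linf N) (W p) (T \<circ> (R \<circ> J)) (1 / C)"
        unfolding bounded_below_by_def
      proof (intro conjI ballI)
        fix v :: "nat \<Rightarrow> 'k" assume v: "v \<in> vcarrier (linf N)"
        have TRJ: "T (R (J v)) \<in> vcarrier (W p)"
          by (intro bounded_operatorD(1)[OF T] bounded_operatorD(1)[OF R] Jc v)
        have "vnorm (linf N) v = vnorm (W p) (S (T (R (J v))))" by (simp only: STR[OF Jc[OF v]] Jn)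
        also have "\<dots> \<le> MS * vnorm (W p) (T (R (J v)))" by (rule MS(2)[OF TRJ])
        also have "\<dots> \<le> C * vnorm (W p) (T (R (J v)))" using C by (intro mult_right_mono) auto
        finally show "1 / C * vnorm (linf N) v \<le> vnorm (W p) ((T \<circ> (R \<circ> J)) v)"
          using C by (simp add: divide_le_eq mult.commute)
      qed (use C in simp)
    qed
  qed
  then show ?thesis using C(1) by blast
qed

lemma fixes_linf_uniformly_iff_identity_factors:
  fixes T :: "(nat \<Rightarrow> nat \<Rightarrow> 'k) \<Rightarrow> nat \<Rightarrow> nat \<Rightarrow> 'k::{real_normed_field,banach}"
  assumes p: "p > 1" and T: "bounded_operator (W p) (W p) T"
  shows "fixes_uniformly (W p) (W p) T {linf n | n. n \<ge> 1} \<longleftrightarrow> identity_factors_through (W p) T"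
proof
  assume "fixes_uniformly (W p) (W p) T {linf n | n. n \<ge> 1}"
  then obtain C where "C \<ge> 1" "\<And>N. N \<ge> 1 \<Longrightarrow> fixes_copy C (W p) (W p) T (linf N)"
    unfolding fixes_uniformly_def by blast
  then show "identity_factors_through (W p) T" by (rule identity_factors_if_fixes_linf[OF p T])
next
  assume "identity_factors_through (W p) T"
  then show "fixes_uniformly (W p) (W p) T {linf n | n. n \<ge> 1}"
    using fixes_linf_if_identity_factors[OF p T] unfolding fixes_uniformly_def by blast
qed

theorem theorem1p3:
  fixes p :: real
  assumes "1 < p"
  shows "(\<forall>T. bounded_operator (W p :: (real, nat \<Rightarrow> nat \<Rightarrow> real) nspace) (W p) T \<longrightarrow>
            (fixes_uniformly (W p) (W p) T {linf n | n. n \<ge> 1} \<longleftrightarrow> identity_factors_through (W p) T)) \<and>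
         (\<forall>T. bounded_operator (W p :: (complex, nat \<Rightarrow> nat \<Rightarrow> complex) nspace) (W p) T \<longrightarrow>
            (fixes_uniformly (W p) (W p) T {linf n | n. n \<ge> 1} \<longleftrightarrow> identity_factors_through (W p) T))"
  by (intro conjI allI impI fixes_linf_uniformly_iff_identity_factors[OF assms])

end
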